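(* Let $G=\langle s_1,\ldots,s_r\rangle$ be the free group of rank $r$ and let $G$ act by measure-preserving transformations on a probability space $(X,\mu)$. If $\alpha$ and $\beta$ are finite measurable generating partitions of $X$, then $f(\alpha)=f(\beta)$. Hence this common number, denoted $f(G,X,\mu)$, is a measure-conjugacy invariant: if $(G,X,\mu)$ and $(G,Y,\nu)$ are measurably conjugate systems that have finite generating partitions, then $f(G,X,\mu)=f(G,Y,\nu)$.
   Context: A system $(G,X,\mu)$ is a probability space $(X,\mu)$ with an action of $G$ by measure-preserving transformations. Two systems $(G,X,\mu)$ and $(G,Y,\nu)$ are measurably conjugate if there exist conull sets $X'\subset X$, $Y'\subset Y$ and a bijective measurable map $\phi:X'\to Y'$ with $\phi^{-1}$ measurable, $\phi_*\mu=\nu$ and $\phi(gx)=g\phi(x)$ for all $g\in G$, $x\in X'$. A finite partition $\alpha=\{A_1,\dots,A_n\}$ of $X$ is a finite collection of pairwise disjoint measurable sets with union $X$. For $g\in G$, $g\alpha=\{gA : A\in\alpha\}$. The join of partitions is $\alpha\vee\beta=\{A\cap B : A\in\alpha, B\in\beta\}$. A partition $\alpha$ is generating if the smallest $G$-invariant $\sigma$-algebra containing $\alpha$ is the $\sigma$-algebra of all measurable sets, up to sets of measure zero. Let $B(e,n)\subset G$ denote the ball of radius $n$ centered at the identity $e$ with respect to the word metric induced by $S=\{s_1^{\pm1},\ldots,s_r^{\pm1}\}$. Define $$H(\alpha)=-\sum_{A\in\alpha}\mu(A)\log(\mu(A))\quad(0\log 0=0),$$ $$F(\alpha)=(1-2r)H(\alpha)+\sum_{i=1}^r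 H(\alpha\vee s_i\alpha),$$ $$\alpha^n=\bigvee_{g\in B(e,n)}g\alpha,\qquad f(\alpha)=\inf_{n} F(\alpha^n),$$ where the infimum is over integers $n\ge 0$ and is taken in $[-\infty,\infty)$. *)

theory Defs
  imports "HOL-Probability.Probability" "HOL-Algebra.Group_Action"
begin

text \<open>
  A letter \<open>(i, True)\<close> stands for the generator \<open>s i\<close> and \<open>(i, False)\<close> for its inverse;
  generators are indexed by \<open>{1..r}\<close>.
\<close>

definition reduced_words :: "nat \<Rightarrow> (nat \<times> bool) list set" where
  "reduced_words r = {w. fst ` set w \<subseteq> {1..r} \<and>
     (\<forall>k. Suc k < length w \<longrightarrow>
        \<not> (fst (w ! k) = fst (w ! Suc k) \<and> snd (w ! k) \<noteq> snd (w ! Suc k)))}"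

definition list_mult :: "('g, 'c) monoid_scheme \<Rightarrow> 'g list \<Rightarrow> 'g" where
  "list_mult G xs = foldr (\<lambda>x y. x \<otimes>\<^bsub>G\<^esub> y) xs \<one>\<^bsub>G\<^esub>"

definition word_eval :: "('g, 'c) monoid_scheme \<Rightarrow> (nat \<Rightarrow> 'g) \<Rightarrow> (nat \<times> bool) list \<Rightarrow> 'g" where
  "word_eval G s w = list_mult G (map (\<lambda>(i, b). if b then s i else inv\<^bsub>G\<^esub> (s i)) w)"

text \<open>
  \<open>G\<close> is the free group of rank \<open>r\<close> with free generators \<open>s 1, \<dots>, s r\<close>: every element of \<open>G\<close>
  is the value of exactly one reduced word.
\<close>

definition free_group_on :: "('g, 'c) monoid_scheme \<Rightarrow> nat \<Rightarrow> (nat \<Rightarrow> 'g) \<Rightarrow> bool" where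
  "free_group_on G r s \<longleftrightarrow>
     group G \<and> s ` {1..r} \<subseteq> carrier G \<and>
     bij_betw (word_eval G s) (reduced_words r) (carrier G)"

definition sym_gens :: "('g, 'c) monoid_scheme \<Rightarrow> nat \<Rightarrow> (nat \<Rightarrow> 'g) \<Rightarrow> 'g set" where
  "sym_gens G r s = s ` {1..r} \<union> (\<lambda>i. inv\<^bsub>G\<^esub> (s i)) ` {1..r}"

definition word_length :: "('g, 'c) monoid_scheme \<Rightarrow> 'g set \<Rightarrow> 'g \<Rightarrow> nat" where
  "word_length G S g = (LEAST n. \<exists>xs. set xs \<subseteq> S \<and> length xs = n \<and> list_mult G xs = g)"

definition word_dist :: "('g, 'c) monoid_scheme \<Rightarrow> 'g set \<Rightarrow> 'g \<Rightarrow> 'g \<Rightarrow> nat" where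
  "word_dist G S g h = word_length G S (inv\<^bsub>G\<^esub> g \<otimes>\<^bsub>G\<^esub> h)"

text \<open>Balls are closed, so that the ball of radius \<open>0\<close> consists of the centre.\<close>

definition word_ball :: "('g, 'c) monoid_scheme \<Rightarrow> 'g set \<Rightarrow> 'g \<Rightarrow> nat \<Rightarrow> 'g set" where
  "word_ball G S g n = {h \<in> carrier G. word_dist G S g h \<le> n}"

text \<open>
  \<open>group_action\<close> makes each \<open>T g\<close> a bijection of \<open>space M\<close> that is \<open>undefined\<close> off \<open>space M\<close>;
  the latter is only a normalisation.
\<close>

definition mp_system ::
  "('g, 'c) monoid_scheme \<Rightarrow> 'x measure \<Rightarrow> ('g \<Rightarrow> 'x \<Rightarrow> 'x) \<Rightarrow> bool" where
  "mp_system G M T \<longleftrightarrow>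
     prob_space M \<and> group_action G (space M) T \<and>
     (\<forall>g\<in>carrier G. T g \<in> measurable M M \<and> distr M M (T g) = M)"

text \<open>
  Conull sets are measurable sets with null complement.  The equation
  \<open>\<phi> (g x) = g (\<phi> x)\<close> for all \<open>g\<close> and all \<open>x \<in> X'\<close> presupposes \<open>g x \<in> X'\<close>, i.e. that \<open>X'\<close>
  is invariant.
\<close>

definition measurably_conjugate ::
  "('g, 'c) monoid_scheme \<Rightarrow> 'x measure \<Rightarrow> ('g \<Rightarrow> 'x \<Rightarrow> 'x) \<Rightarrow>
   'y measure \<Rightarrow> ('g \<Rightarrow> 'y \<Rightarrow> 'y) \<Rightarrow> bool" where
  "measurably_conjugate G M T N U \<longleftrightarrow>
     (\<exists>X' Y' \<phi>.
        X' \<in> sets M \<and> space M - X' \<in> null_sets M \<and>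
        Y' \<in> sets N \<and> space N - Y' \<in> null_sets N \<and>
        bij_betw \<phi> X' Y' \<and>
        \<phi> \<in> measurable (restrict_space M X') (restrict_space N Y') \<and>
        the_inv_into X' \<phi> \<in> measurable (restrict_space N Y') (restrict_space M X') \<and>
        distr (restrict_space M X') (restrict_space N Y') \<phi> = restrict_space N Y' \<and>
        (\<forall>g\<in>carrier G. \<forall>x\<in>X'. T g x \<in> X' \<and> \<phi> (T g x) = U g (\<phi> x)))"

text \<open>
  Unlike \<open>partition_on\<close>, the empty set is allowed as a member, since joins may produce it.
\<close>

definition finite_partition :: "'x measure \<Rightarrow> 'x set set \<Rightarrow> bool" where
  "finite_partition M \<alpha> \<longleftrightarrow>
     finite \<alpha> \<and> \<alpha> \<subseteq> sets M \<and> disjoint \<alpha> \<and> \<Union>\<alpha> = space M"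

definition translate :: "('x \<Rightarrow> 'x) \<Rightarrow> 'x set set \<Rightarrow> 'x set set" where
  "translate t \<alpha> = {t ` A | A. A \<in> \<alpha>}"

definition partition_join :: "'x set set \<Rightarrow> 'x set set \<Rightarrow> 'x set set" where
  "partition_join \<alpha> \<beta> = {A \<inter> B | A B. A \<in> \<alpha> \<and> B \<in> \<beta>}"

text \<open>The join of a finite nonempty family of partitions \<open>P g\<close>, \<open>g \<in> K\<close>.\<close>

definition partition_Join :: "'g set \<Rightarrow> ('g \<Rightarrow> 'x set set) \<Rightarrow> 'x set set" where
  "partition_Join K P = {(\<Inter>g\<in>K. c g) | c. \<forall>g\<in>K. c g \<in> P g}"

definition invariant_sigma_algebra ::
  "('g, 'c) monoid_scheme \<Rightarrow> 'x measure \<Rightarrow> ('g \<Rightarrow> 'x \<Rightarrow> 'x) \<Rightarrow> 'x set set \<Rightarrow> bool" where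
  "invariant_sigma_algebra G M T \<B> \<longleftrightarrow>
     sigma_algebra (space M) \<B> \<and> (\<forall>g\<in>carrier G. \<forall>B\<in>\<B>. T g ` B \<in> \<B>)"

definition smallest_invariant_sigma_algebra ::
  "('g, 'c) monoid_scheme \<Rightarrow> 'x measure \<Rightarrow> ('g \<Rightarrow> 'x \<Rightarrow> 'x) \<Rightarrow> 'x set set \<Rightarrow> 'x set set" where
  "smallest_invariant_sigma_algebra G M T \<alpha> =
     \<Inter>{\<B>. invariant_sigma_algebra G M T \<B> \<and> \<alpha> \<subseteq> \<B>}"

definition generating ::
  "('g, 'c) monoid_scheme \<Rightarrow> 'x measure \<Rightarrow> ('g \<Rightarrow> 'x \<Rightarrow> 'x) \<Rightarrow> 'x set set \<Rightarrow> bool" where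
  "generating G M T \<alpha> \<longleftrightarrow>
     (\<forall>A\<in>sets M. \<exists>B\<in>smallest_invariant_sigma_algebra G M T \<alpha>.
        (A - B) \<union> (B - A) \<in> null_sets M)"

definition finite_generating_partition ::
  "('g, 'c) monoid_scheme \<Rightarrow> 'x measure \<Rightarrow> ('g \<Rightarrow> 'x \<Rightarrow> 'x) \<Rightarrow> 'x set set \<Rightarrow> bool" where
  "finite_generating_partition G M T \<alpha> \<longleftrightarrow> finite_partition M \<alpha> \<and> generating G M T \<alpha>"

text \<open>The convention \<open>0 log 0 = 0\<close> holds automatically.\<close>

definition partition_entropy :: "'x measure \<Rightarrow> 'x set set \<Rightarrow> real" where
  "partition_entropy M \<alpha> = - (\<Sum>A\<in>\<alpha>. measure M A * ln (measure M A))"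

definition F_partition ::
  "nat \<Rightarrow> (nat \<Rightarrow> 'g) \<Rightarrow> 'x measure \<Rightarrow> ('g \<Rightarrow> 'x \<Rightarrow> 'x) \<Rightarrow> 'x set set \<Rightarrow> real" where
  "F_partition r s M T \<alpha> =
     (1 - 2 * real r) * partition_entropy M \<alpha> +
     (\<Sum>i=1..r. partition_entropy M (partition_join \<alpha> (translate (T (s i)) \<alpha>)))"

definition ball_join ::
  "('g, 'c) monoid_scheme \<Rightarrow> nat \<Rightarrow> (nat \<Rightarrow> 'g) \<Rightarrow> ('g \<Rightarrow> 'x \<Rightarrow> 'x) \<Rightarrow>
   'x set set \<Rightarrow> nat \<Rightarrow> 'x set set" where
  "ball_join G r s T \<alpha> n =
     partition_Join (word_ball G (sym_gens G r s) \<one>\<^bsub>G\<^esub> n) (\<lambda>g. translate (T g) \<alpha>)"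

definition f_partition ::
  "('g, 'c) monoid_scheme \<Rightarrow> nat \<Rightarrow> (nat \<Rightarrow> 'g) \<Rightarrow> 'x measure \<Rightarrow> ('g \<Rightarrow> 'x \<Rightarrow> 'x) \<Rightarrow>
   'x set set \<Rightarrow> ereal" where
  "f_partition G r s M T \<alpha> = (INF n. ereal (F_partition r s M T (ball_join G r s T \<alpha> n)))"

text \<open>
  The common value of \<open>f\<close> on the finite generating partitions of a system; meaningful only if
  the system has such a partition.
\<close>

definition f_invariant ::
  "('g, 'c) monoid_scheme \<Rightarrow> nat \<Rightarrow> (nat \<Rightarrow> 'g) \<Rightarrow> 'x measure \<Rightarrow> ('g \<Rightarrow> 'x \<Rightarrow> 'x) \<Rightarrow> ereal" where
  "f_invariant G r s M T =
     (THE c. \<exists>\<alpha>. finite_generating_partition G M T \<alpha> \<and> c = f_partition G r s M T \<alpha>)"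

end

theory Submission
  imports Defs
begin

text \<open>
  Write \<open>H(\<alpha> | \<gamma>) = H(\<alpha> \<or> \<gamma>) - H(\<gamma>)\<close> for conditional entropy and \<open>\<or>\<close> for the join of partitions.  The
  key fact (\<open>F_simple_splitting\<close>) is that \<open>F\<close> does not increase when \<open>\<alpha>\<close> is replaced by \<open>\<alpha> \<or> t \<beta>\<close> with
  \<open>t\<close> a generator or its inverse and \<open>\<beta>\<close> coarser than \<open>\<alpha>\<close>: with \<open>h = H(t \<beta> | \<alpha>)\<close>, the term
  \<open>(1 - 2r) H\<close> changes by \<open>(1 - 2r) h\<close>, each term \<open>H(\<alpha> \<or> s\<^sub>i \<alpha>)\<close> grows by at most \<open>2h\<close>, and one of
  them by at most \<open>h\<close>.  Since a ball of radius \<open>n + 1\<close> is the union of the ball \<open>B\<close> of radius \<open>n\<close> and of the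
  \<open>t B\<close>, it follows that \<open>F(\<xi> \<or> \<beta>\<^sup>n)\<close> is nonincreasing in \<open>n\<close> for any finite partition \<open>\<xi>\<close>;
  in particular so is \<open>F(\<alpha>\<^sup>n)\<close>.

  Two crude estimates hold for arbitrary finite partitions: \<open>F(\<xi> \<or> \<beta>) \<le> F(\<xi>) + H(\<beta> | \<xi>)\<close>
  (\<open>F_join_le_cond_entropy\<close>) and \<open>F(\<gamma>) \<le> F(\<xi> \<or> \<gamma>) + 2r H(\<xi> | \<gamma>)\<close> (\<open>F_le_F_join\<close>).  Finally, if \<open>\<beta>\<close> is
  generating, then \<open>H(\<xi> | \<beta>\<^sup>k)\<close> becomes arbitrarily small for every finite partition \<open>\<xi>\<close>
  (\<open>generating_cond_entropy_small\<close>).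

  Now let \<open>\<alpha>\<close> and \<open>\<beta>\<close> be generating.  Given \<open>n\<close> and \<open>\<delta> > 0\<close>, let \<open>\<xi> = \<alpha>\<^sup>m\<close> with \<open>m \<ge> n\<close> so large that
  \<open>H(\<beta> | \<xi>) \<le> \<delta>\<close>, and then \<open>k\<close> such that \<open>H(\<xi> | \<beta>\<^sup>k) \<le> \<delta>\<close>.  Then
  \<open>F(\<beta>\<^sup>k) \<le> F(\<xi> \<or> \<beta>\<^sup>k) + 2r\<delta> \<le> F(\<xi> \<or> \<beta>) + 2r\<delta> \<le> F(\<xi>) + (2r + 1)\<delta> \<le> F(\<alpha>\<^sup>n) + (2r + 1)\<delta>\<close>,
  so \<open>f(\<beta>) \<le> f(\<alpha>)\<close>, and equality holds by symmetry.  Invariance under conjugacy follows by pulling a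
  generating partition of one system back to the other.
\<close>


section \<open>Refinement of partitions\<close>

text \<open>
  \<open>finer \<sigma> \<alpha>\<close>: every member of \<open>\<sigma>\<close> lies in a member of \<open>\<alpha>\<close>.  This is only a preorder, since
  members may be empty; two partitions each finer than the other agree up to the empty set.
\<close>

definition finer :: "'a set set \<Rightarrow> 'a set set \<Rightarrow> bool" where
  "finer \<sigma> \<alpha> \<longleftrightarrow> (\<forall>S\<in>\<sigma>. \<exists>A\<in>\<alpha>. S \<subseteq> A)"

lemma finer_refl [simp]: "finer \<alpha> \<alpha>"
  by (auto simp: finer_def)

lemma finer_trans [trans]: "finer \<alpha> \<beta> \<Longrightarrow> finer \<beta> \<gamma> \<Longrightarrow> finer \<alpha> \<gamma>"
  unfolding finer_def by (meson subset_trans)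

lemma finer_partition_join_iff:
  "finer \<rho> (partition_join \<alpha> \<beta>) \<longleftrightarrow> finer \<rho> \<alpha> \<and> finer \<rho> \<beta>"
proof
  have "finer (partition_join \<alpha> \<beta>) \<alpha>" "finer (partition_join \<alpha> \<beta>) \<beta>"
    unfolding finer_def partition_join_def by blast+
  then show "finer \<rho> \<alpha> \<and> finer \<rho> \<beta>" if "finer \<rho> (partition_join \<alpha> \<beta>)"
    using that finer_trans by metis
next
  assume *: "finer \<rho> \<alpha> \<and> finer \<rho> \<beta>"
  show "finer \<rho> (partition_join \<alpha> \<beta>)"
    unfolding finer_def
  proof
    fix S assume "S \<in> \<rho>"
    with * obtain A B where "A \<in> \<alpha>" "S \<subseteq> A" "B \<in> \<beta>" "S \<subseteq> B" unfolding finer_def by meson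
    then show "\<exists>D\<in>partition_join \<alpha> \<beta>. S \<subseteq> D"
      unfolding partition_join_def by (intro bexI[of _ "A \<inter> B"]) auto
  qed
qed

lemma finer_partition_joinD:
  "finer (partition_join \<alpha> \<beta>) \<alpha>" "finer (partition_join \<alpha> \<beta>) \<beta>"
  using finer_partition_join_iff finer_refl by blast+

lemma partition_JoinI:
  assumes "\<And>g. g \<in> K \<Longrightarrow> c g \<in> P g"
  shows "(\<Inter>g\<in>K. c g) \<in> partition_Join K P"
  unfolding partition_Join_def using assms by (intro CollectI exI[of _ c]) simp

lemma partition_JoinE:
  assumes "S \<in> partition_Join K P"
  obtains c where "\<forall>g\<in>K. c g \<in> P g" "S = (\<Inter>g\<in>K. c g)"
proof -
  from assms have "\<exists>c. S = (\<Inter>g\<in>K. c g) \<and> (\<forall>g\<in>K. c g \<in> P g)"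
    unfolding partition_Join_def by (rule CollectD)
  then show thesis by (elim exE conjE) (rule that)
qed

lemma finite_partition_disjointD:
  assumes "finite_partition M \<alpha>" "A \<in> \<alpha>" "A' \<in> \<alpha>" "A \<noteq> A'"
  shows "A \<inter> A' = {}"
  using assms unfolding finite_partition_def by (meson disjointD)

lemma finer_partition_Join_iff:
  "finer \<rho> (partition_Join K P) \<longleftrightarrow> (\<forall>g\<in>K. finer \<rho> (P g))"
proof
  assume \<rho>: "finer \<rho> (partition_Join K P)"
  show "\<forall>g\<in>K. finer \<rho> (P g)"
    unfolding finer_def
  proof (intro ballI)
    fix g S assume "g \<in> K" "S \<in> \<rho>"
    with \<rho> obtain D where D: "D \<in> partition_Join K P" "S \<subseteq> D"
      unfolding finer_def by blast
    from D(1) obtain c where c: "\<forall>g\<in>K. c g \<in> P g" "D = (\<Inter>g\<in>K. c g)"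
      by (rule partition_JoinE)
    with D \<open>g \<in> K\<close> show "\<exists>A\<in>P g. S \<subseteq> A" by (intro bexI[of _ "c g"]) auto
  qed
next
  assume \<rho>: "\<forall>g\<in>K. finer \<rho> (P g)"
  show "finer \<rho> (partition_Join K P)"
    unfolding finer_def
  proof
    fix S assume "S \<in> \<rho>"
    with \<rho> have "\<forall>g\<in>K. \<exists>A. A \<in> P g \<and> S \<subseteq> A" unfolding finer_def by blast
    then obtain c where "\<forall>g\<in>K. c g \<in> P g \<and> S \<subseteq> c g" by metis
    then show "\<exists>A\<in>partition_Join K P. S \<subseteq> A"
      by (intro bexI[of _ "\<Inter>g\<in>K. c g"] partition_JoinI) auto
  qed
qed

lemma partition_join_eq_image: "partition_join \<alpha> \<beta> = (\<lambda>(A, B). A \<inter> B) ` (\<alpha> \<times> \<beta>)"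
  by (auto simp: partition_join_def)

lemma partition_join_commute: "partition_join \<alpha> \<beta> = partition_join \<beta> \<alpha>"
  unfolding partition_join_def by blast

lemma partition_join_assoc:
  "partition_join (partition_join \<alpha> \<beta>) \<gamma> = partition_join \<alpha> (partition_join \<beta> \<gamma>)"
proof -
  have "partition_join (partition_join \<alpha> \<beta>) \<gamma> = {A \<inter> B \<inter> C | A B C. A \<in> \<alpha> \<and> B \<in> \<beta> \<and> C \<in> \<gamma>}"
    unfolding partition_join_def by blast
  also have "\<dots> = {A \<inter> (B \<inter> C) | A B C. A \<in> \<alpha> \<and> B \<in> \<beta> \<and> C \<in> \<gamma>}"
    by (simp only: Int_assoc)
  also have "\<dots> = partition_join \<alpha> (partition_join \<beta> \<gamma>)"
    unfolding partition_join_def by blast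
  finally show ?thesis .
qed

lemma finer_translate:
  assumes "finer \<alpha> \<beta>"
  shows "finer (translate t \<alpha>) (translate t \<beta>)"
  unfolding finer_def
proof
  fix S assume "S \<in> translate t \<alpha>"
  then obtain A where "A \<in> \<alpha>" "S = t ` A" unfolding translate_def by blast
  moreover obtain B where "B \<in> \<beta>" "A \<subseteq> B" using assms \<open>A \<in> \<alpha>\<close> unfolding finer_def by blast
  ultimately show "\<exists>B\<in>translate t \<beta>. S \<subseteq> B"
    unfolding translate_def by (intro bexI[of _ "t ` B"]) auto
qed

lemma finite_partition_join:
  assumes "finite_partition M \<alpha>" "finite_partition M \<beta>"
  shows "finite_partition M (partition_join \<alpha> \<beta>)"
proof -
  have "disjoint (partition_join \<alpha> \<beta>)"
  proof (rule disjointI)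
    fix S S' assume "S \<in> partition_join \<alpha> \<beta>" "S' \<in> partition_join \<alpha> \<beta>" "S \<noteq> S'"
    then obtain A B A' B' where AB: "A \<in> \<alpha>" "B \<in> \<beta>" "S = A \<inter> B" "A' \<in> \<alpha>" "B' \<in> \<beta>" "S' = A' \<inter> B'"
      unfolding partition_join_def by blast
    with \<open>S \<noteq> S'\<close> have "A \<noteq> A' \<or> B \<noteq> B'" by blast
    then have "A \<inter> A' = {} \<or> B \<inter> B' = {}"
      using AB assms finite_partition_disjointD by metis
    with AB show "S \<inter> S' = {}" by blast
  qed
  moreover have "\<Union>(partition_join \<alpha> \<beta>) = \<Union>\<alpha> \<inter> \<Union>\<beta>"
    unfolding partition_join_def by blast
  ultimately show ?thesis
    using assms unfolding finite_partition_def by (auto simp: partition_join_eq_image)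
qed

lemma finite_partition_Join:
  assumes "finite K" "K \<noteq> {}" and P: "\<And>g. g \<in> K \<Longrightarrow> finite_partition M (P g)"
  shows "finite_partition M (partition_Join K P)"
proof -
  have "partition_Join K P \<subseteq> (\<lambda>c. \<Inter>g\<in>K. c g) ` (Pi\<^sub>E K P)"
  proof
    fix S assume "S \<in> partition_Join K P"
    then obtain c where "\<forall>g\<in>K. c g \<in> P g" "S = (\<Inter>g\<in>K. c g)" by (rule partition_JoinE)
    then show "S \<in> (\<lambda>c. \<Inter>g\<in>K. c g) ` (Pi\<^sub>E K P)"
      by (intro image_eqI[of _ _ "restrict c K"]) auto
  qed
  moreover have "finite (Pi\<^sub>E K P)"
    using assms by (auto intro!: finite_PiE simp: finite_partition_def)
  ultimately have "finite (partition_Join K P)"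
    using finite_subset finite_imageI by blast
  moreover have "partition_Join K P \<subseteq> sets M"
  proof
    fix S assume "S \<in> partition_Join K P"
    then obtain c where c: "\<forall>g\<in>K. c g \<in> P g" "S = (\<Inter>g\<in>K. c g)" by (rule partition_JoinE)
    have "c g \<in> sets M" if "g \<in> K" for g
      using c(1) that P[OF that] by (auto simp: finite_partition_def)
    with c assms(1,2) show "S \<in> sets M" by auto
  qed
  moreover have "disjoint (partition_Join K P)"
  proof (rule disjointI)
    fix S S' assume S: "S \<in> partition_Join K P" "S' \<in> partition_Join K P" "S \<noteq> S'"
    from S(1) obtain c where c: "\<forall>g\<in>K. c g \<in> P g" "S = (\<Inter>g\<in>K. c g)"
      by (rule partition_JoinE)
    from S(2) obtain c' where c': "\<forall>g\<in>K. c' g \<in> P g" "S' = (\<Inter>g\<in>K. c' g)"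
      by (rule partition_JoinE)
    from S(3) c c' obtain g where g: "g \<in> K" "c g \<noteq> c' g" by force
    with c(1) c'(1) have "c g \<inter> c' g = {}"
      by (intro finite_partition_disjointD[OF P[OF g(1)]]) auto
    moreover have "S \<subseteq> c g" "S' \<subseteq> c' g" using c(2) c'(2) g(1) by auto
    ultimately show "S \<inter> S' = {}" by blast
  qed
  moreover have "\<Union>(partition_Join K P) = space M"
  proof (intro equalityI subsetI)
    fix x assume "x \<in> \<Union>(partition_Join K P)"
    then obtain S where S: "x \<in> S" "S \<in> partition_Join K P" by blast
    from S(2) obtain c where c: "\<forall>g\<in>K. c g \<in> P g" "S = (\<Inter>g\<in>K. c g)"
      by (rule partition_JoinE)
    from \<open>K \<noteq> {}\<close> obtain g where g: "g \<in> K" by blast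
    then have "x \<in> c g" using S(1) c(2) by blast
    with c(1) g P[OF g] show "x \<in> space M" unfolding finite_partition_def by blast
  next
    fix x assume "x \<in> space M"
    with P have "\<forall>g\<in>K. \<exists>A. A \<in> P g \<and> x \<in> A" unfolding finite_partition_def by blast
    then obtain c where "\<forall>g\<in>K. c g \<in> P g \<and> x \<in> c g" by metis
    then show "x \<in> \<Union>(partition_Join K P)"
      by (intro UnionI[OF partition_JoinI, of _ c]) auto
  qed
  ultimately show ?thesis unfolding finite_partition_def by blast
qed

text \<open>
  Distinct pairs \<open>(A, B)\<close> have distinct intersections unless these are empty, so a sum over the join
  is a double sum as soon as the empty set contributes nothing.
\<close>

lemma sum_partition_join:
  assumes "finite_partition M \<alpha>" "finite_partition M \<beta>" and "\<phi> {} = (0 :: real)"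
  shows "sum \<phi> (partition_join \<alpha> \<beta>) = (\<Sum>A\<in>\<alpha>. \<Sum>B\<in>\<beta>. \<phi> (A \<inter> B))"
proof -
  have fin: "finite (\<alpha> \<times> \<beta>)" using assms by (auto simp: finite_partition_def)
  have "sum \<phi> (partition_join \<alpha> \<beta>) = (\<Sum>p\<in>\<alpha> \<times> \<beta>. \<phi> (case p of (A, B) \<Rightarrow> A \<inter> B))"
    unfolding partition_join_eq_image
  proof (subst sum.reindex_nontrivial[OF fin])
    fix p q assume *: "p \<in> \<alpha> \<times> \<beta>" "q \<in> \<alpha> \<times> \<beta>" "p \<noteq> q"
      "(case p of (A, B) \<Rightarrow> A \<inter> B) = (case q of (A, B) \<Rightarrow> A \<inter> B)"
    obtain A B A' B' where pq: "p = (A, B)" "q = (A', B')" by (cases p, cases q)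
    from * pq have "A \<noteq> A' \<or> B \<noteq> B'" by auto
    then have "A \<inter> A' = {} \<or> B \<inter> B' = {}"
      using * pq finite_partition_disjointD[OF assms(1), of A A']
        finite_partition_disjointD[OF assms(2), of B B'] by auto
    with * pq have "A \<inter> B = {}" by auto
    with pq assms(3) show "\<phi> (case p of (A, B) \<Rightarrow> A \<inter> B) = 0" by simp
  qed (simp add: comp_def)
  also have "\<dots> = (\<Sum>A\<in>\<alpha>. \<Sum>B\<in>\<beta>. \<phi> (A \<inter> B))"
    by (simp add: sum.cartesian_product case_prod_unfold)
  finally show ?thesis .
qed

section \<open>Entropy of finite partitions\<close>

text \<open>The entropy \<open>H(\<alpha> | \<gamma>)\<close> of \<open>\<alpha>\<close> given \<open>\<gamma>\<close>, defined by the chain rule.\<close>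

definition cond_entropy :: "'a measure \<Rightarrow> 'a set set \<Rightarrow> 'a set set \<Rightarrow> real" where
  "cond_entropy M \<alpha> \<gamma> = partition_entropy M (partition_join \<alpha> \<gamma>) - partition_entropy M \<gamma>"

lemma cross_term_le:
  fixes q a b c :: real
  assumes "0 \<le> q" "q \<le> a" "q \<le> b" "q \<le> c"
  shows "q * ln a + q * ln b - q * ln q - q * ln c \<le> a * b / c - q"
proof (cases "q = 0")
  case False
  with assms have pos: "q > 0" "a > 0" "b > 0" "c > 0" by auto
  then have "q * ln a + q * ln b - q * ln q - q * ln c = q * ln (a * b / (q * c))"
    by (simp add: ln_mult ln_div algebra_simps)
  also have "\<dots> \<le> q * (a * b / (q * c) - 1)"
    using pos by (intro mult_left_mono ln_le_minus_one) auto
  also have "\<dots> = a * b / c - q" using pos by (simp add: field_simps)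
  finally show ?thesis .
qed (use assms in auto)

context prob_space
begin

lemma sum_prob_partition:
  assumes "finite_partition M \<beta>" "A \<in> sets M"
  shows "(\<Sum>B\<in>\<beta>. prob (A \<inter> B)) = prob A"
proof -
  have "A = (\<Union>B\<in>\<beta>. A \<inter> B)"
    using assms sets.sets_into_space[OF assms(2)] unfolding finite_partition_def by blast
  moreover have "prob (\<Union>B\<in>\<beta>. A \<inter> B) = (\<Sum>B\<in>\<beta>. prob (A \<inter> B))"
    using assms unfolding finite_partition_def
    by (intro finite_measure_finite_Union) (auto simp: disjoint_family_on_def disjoint_def)
  ultimately show ?thesis by simp
qed

lemma partition_entropy_join:
  assumes "finite_partition M \<alpha>" "finite_partition M \<beta>"
  shows "partition_entropy M (partition_join \<alpha> \<beta>) =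
           - (\<Sum>A\<in>\<alpha>. \<Sum>B\<in>\<beta>. prob (A \<inter> B) * ln (prob (A \<inter> B)))"
  unfolding partition_entropy_def
  by (subst sum_partition_join[OF assms]) auto

text \<open>
  Strong subadditivity.  For each \<open>C\<close> in \<open>\<gamma>\<close> the inequality \<open>cross_term_le\<close> is summed over the pairs
  \<open>(A, B)\<close>, where \<open>q\<close>, \<open>a\<close>, \<open>b\<close>, \<open>c\<close> are the measures of \<open>A \<inter> B \<inter> C\<close>, \<open>A \<inter> C\<close>, \<open>B \<inter> C\<close>, \<open>C\<close>;
  the right-hand sides then cancel.
\<close>

lemma entropy_submodular:
  assumes \<alpha>: "finite_partition M \<alpha>" and \<beta>: "finite_partition M \<beta>" and \<gamma>: "finite_partition M \<gamma>"
  shows "partition_entropy M (partition_join (partition_join \<alpha> \<beta>) \<gamma>) + partition_entropy M \<gamma>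
       \<le> partition_entropy M (partition_join \<alpha> \<gamma>) + partition_entropy M (partition_join \<beta> \<gamma>)"
proof -
  define \<eta> where "\<eta> x = x * ln x" for x :: real
  have sets: "A \<in> sets M" if "A \<in> \<alpha> \<union> \<beta> \<union> \<gamma>" for A
    using that assms unfolding finite_partition_def by blast
  have C: "(\<Sum>A\<in>\<alpha>. \<eta> (prob (A \<inter> C))) + (\<Sum>B\<in>\<beta>. \<eta> (prob (B \<inter> C)))
             - (\<Sum>A\<in>\<alpha>. \<Sum>B\<in>\<beta>. \<eta> (prob (A \<inter> B \<inter> C))) - \<eta> (prob C) \<le> 0"
    if "C \<in> \<gamma>" for C
  proof -
    define q a b c where "q A B = prob (A \<inter> B \<inter> C)" "a A = prob (A \<inter> C)"
      "b B = prob (B \<inter> C)" "c = prob C" for A B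
    note defs = q_a_b_c_def
    have sa: "(\<Sum>B\<in>\<beta>. q A B) = a A" if "A \<in> \<alpha>" for A
      using sum_prob_partition[OF \<beta>, of "A \<inter> C"] sets that \<open>C \<in> \<gamma>\<close>
      by (simp add: defs Int_ac sets.Int)
    have sb: "(\<Sum>A\<in>\<alpha>. q A B) = b B" if "B \<in> \<beta>" for B
      using sum_prob_partition[OF \<alpha>, of "B \<inter> C"] sets that \<open>C \<in> \<gamma>\<close>
      by (simp add: defs Int_ac sets.Int)
    have ca: "(\<Sum>A\<in>\<alpha>. a A) = c" and cb: "(\<Sum>B\<in>\<beta>. b B) = c"
      using sum_prob_partition[OF \<alpha>, of C] sum_prob_partition[OF \<beta>, of C] sets \<open>C \<in> \<gamma>\<close>
      by (simp_all add: defs Int_ac)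
    have "(\<Sum>A\<in>\<alpha>. \<Sum>B\<in>\<beta>. q A B * ln (a A) + q A B * ln (b B) - \<eta> (q A B) - q A B * ln c)
        \<le> (\<Sum>A\<in>\<alpha>. \<Sum>B\<in>\<beta>. a A * b B / c - q A B)"
      unfolding \<eta>_def
    proof (intro sum_mono cross_term_le)
      fix A B assume "A \<in> \<alpha>" "B \<in> \<beta>"
      then show "0 \<le> q A B" "q A B \<le> a A" "q A B \<le> b B" "q A B \<le> c"
        using sets \<open>C \<in> \<gamma>\<close> by (auto simp: defs intro!: finite_measure_mono)
    qed
    also have "\<dots> = (\<Sum>A\<in>\<alpha>. a A) * (\<Sum>B\<in>\<beta>. b B) / c - (\<Sum>A\<in>\<alpha>. \<Sum>B\<in>\<beta>. q A B)"
      by (simp add: sum_subtractf sum_product sum_divide_distrib)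
    also have "\<dots> = 0" by (simp add: sa ca cb)
    finally have *: "(\<Sum>A\<in>\<alpha>. \<Sum>B\<in>\<beta>. q A B * ln (a A)) + (\<Sum>A\<in>\<alpha>. \<Sum>B\<in>\<beta>. q A B * ln (b B))
        - (\<Sum>A\<in>\<alpha>. \<Sum>B\<in>\<beta>. \<eta> (q A B)) - (\<Sum>A\<in>\<alpha>. \<Sum>B\<in>\<beta>. q A B * ln c) \<le> 0"
      by (simp add: sum.distrib sum_subtractf)
    have "(\<Sum>A\<in>\<alpha>. \<Sum>B\<in>\<beta>. q A B * ln (a A)) = (\<Sum>A\<in>\<alpha>. \<eta> (a A))"
      by (simp add: sum_distrib_right[symmetric] sa \<eta>_def)
    moreover have "(\<Sum>A\<in>\<alpha>. \<Sum>B\<in>\<beta>. q A B * ln (b B)) = (\<Sum>B\<in>\<beta>. \<eta> (b B))"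
      by (subst sum.swap) (simp add: sum_distrib_right[symmetric] sb \<eta>_def)
    moreover have "(\<Sum>A\<in>\<alpha>. \<Sum>B\<in>\<beta>. q A B * ln c) = \<eta> c"
      by (simp add: sum_distrib_right[symmetric] sa ca \<eta>_def)
    ultimately show ?thesis using * by (simp add: defs)
  qed
  have H3: "partition_entropy M (partition_join (partition_join \<alpha> \<beta>) \<gamma>) =
      - (\<Sum>C\<in>\<gamma>. \<Sum>A\<in>\<alpha>. \<Sum>B\<in>\<beta>. \<eta> (prob (A \<inter> B \<inter> C)))"
  proof -
    have "partition_entropy M (partition_join (partition_join \<alpha> \<beta>) \<gamma>) =
      - (\<Sum>C\<in>\<gamma>. \<Sum>D\<in>partition_join \<alpha> \<beta>. \<eta> (prob (D \<inter> C)))"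
      unfolding \<eta>_def
      by (subst partition_entropy_join[OF finite_partition_join[OF \<alpha> \<beta>] \<gamma>], subst sum.swap) simp
    then show ?thesis by (simp add: sum_partition_join[OF \<alpha> \<beta>] \<eta>_def)
  qed
  have H2: "partition_entropy M (partition_join \<delta> \<gamma>) = - (\<Sum>C\<in>\<gamma>. \<Sum>A\<in>\<delta>. \<eta> (prob (A \<inter> C)))"
    if "finite_partition M \<delta>" for \<delta>
    unfolding \<eta>_def by (subst partition_entropy_join[OF that \<gamma>], subst sum.swap) simp
  have H1: "partition_entropy M \<gamma> = - (\<Sum>C\<in>\<gamma>. \<eta> (prob C))"
    by (simp add: partition_entropy_def \<eta>_def)
  have "(\<Sum>C\<in>\<gamma>. (\<Sum>A\<in>\<alpha>. \<eta> (prob (A \<inter> C))) + (\<Sum>B\<in>\<beta>. \<eta> (prob (B \<inter> C)))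
             - (\<Sum>A\<in>\<alpha>. \<Sum>B\<in>\<beta>. \<eta> (prob (A \<inter> B \<inter> C))) - \<eta> (prob C)) \<le> 0"
    by (intro sum_nonpos C)
  then show ?thesis
    by (simp add: H3 H2[OF \<alpha>] H2[OF \<beta>] H1 sum.distrib sum_subtractf)
qed

lemma entropy_join_finer:
  assumes \<alpha>: "finite_partition M \<alpha>" and \<beta>: "finite_partition M \<beta>" and fin: "finer \<beta> \<alpha>"
  shows "partition_entropy M (partition_join \<alpha> \<beta>) = partition_entropy M \<beta>"
proof -
  have "(\<Sum>A\<in>\<alpha>. prob (A \<inter> B) * ln (prob (A \<inter> B))) = prob B * ln (prob B)" if "B \<in> \<beta>" for B
  proof -
    from fin that obtain A where A: "A \<in> \<alpha>" "B \<subseteq> A" unfolding finer_def by blast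
    have "A' \<inter> B = {}" if "A' \<in> \<alpha> - {A}" for A'
      using that A \<alpha> unfolding finite_partition_def disjoint_def by blast
    then have "(\<Sum>A\<in>\<alpha>. prob (A \<inter> B) * ln (prob (A \<inter> B))) =
        (\<Sum>A\<in>{A}. prob (A \<inter> B) * ln (prob (A \<inter> B)))"
      using \<alpha> A by (intro sum.mono_neutral_right) (auto simp: finite_partition_def)
    with A show ?thesis by (simp add: Int_absorb1)
  qed
  then show ?thesis
    by (subst partition_entropy_join[OF \<alpha> \<beta>], subst sum.swap) (simp add: partition_entropy_def)
qed

text \<open>
  Strong subadditivity for \<open>\<alpha>\<close>, \<open>\<alpha>\<close> and \<open>\<beta>\<close> reads \<open>H(\<alpha> \<or> \<beta>) + H(\<beta>) \<le> 2 H(\<alpha> \<or> \<beta>)\<close>.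
\<close>

lemma entropy_le_join:
  assumes \<alpha>: "finite_partition M \<alpha>" and \<beta>: "finite_partition M \<beta>"
  shows "partition_entropy M \<beta> \<le> partition_entropy M (partition_join \<alpha> \<beta>)"
proof -
  have "partition_entropy M (partition_join \<alpha> (partition_join \<alpha> \<beta>)) =
        partition_entropy M (partition_join \<alpha> \<beta>)"
    by (intro entropy_join_finer finite_partition_join finer_partition_joinD assms)
  moreover have "partition_join \<alpha> (partition_join \<alpha> \<beta>) = partition_join (partition_join \<alpha> \<alpha>) \<beta>"
    by (rule partition_join_assoc[symmetric])
  ultimately show ?thesis using entropy_submodular[OF \<alpha> \<alpha> \<beta>] by simp
qed

lemma entropy_mono:
  assumes "finite_partition M \<alpha>" "finite_partition M \<beta>" "finer \<beta> \<alpha>"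
  shows "partition_entropy M \<alpha> \<le> partition_entropy M \<beta>"
proof -
  show ?thesis
    using partition_join_commute[of \<alpha> \<beta>] entropy_join_finer[OF assms] entropy_le_join[OF assms(2,1)] by simp
qed

lemma entropy_cong:
  assumes "finite_partition M \<alpha>" "finite_partition M \<beta>" "finer \<beta> \<alpha>" "finer \<alpha> \<beta>"
  shows "partition_entropy M \<alpha> = partition_entropy M \<beta>"
  using entropy_mono assms by (intro antisym) auto


lemma cond_entropy_nonneg:
  assumes "finite_partition M \<alpha>" "finite_partition M \<gamma>"
  shows "0 \<le> cond_entropy M \<alpha> \<gamma>"
  using entropy_le_join[OF assms] by (simp add: cond_entropy_def)

lemma cond_entropy_eq_0:
  assumes "finite_partition M \<alpha>" "finite_partition M \<gamma>" "finer \<gamma> \<alpha>"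
  shows "cond_entropy M \<alpha> \<gamma> = 0"
  using entropy_join_finer[OF assms] by (simp add: cond_entropy_def)

lemma cond_entropy_mono:
  assumes "finite_partition M \<alpha>" "finite_partition M \<beta>" "finite_partition M \<gamma>" "finer \<beta> \<alpha>"
  shows "cond_entropy M \<alpha> \<gamma> \<le> cond_entropy M \<beta> \<gamma>"
proof -
  have "finer (partition_join \<beta> \<gamma>) (partition_join \<alpha> \<gamma>)"
    using finer_trans[OF finer_partition_joinD(1) assms(4)] finer_partition_joinD(2)
    by (simp add: finer_partition_join_iff)
  then show ?thesis
    using entropy_mono[OF finite_partition_join finite_partition_join] assms(1-3)
    by (simp add: cond_entropy_def)
qed

lemma cond_entropy_antimono:
  assumes fp: "finite_partition M \<alpha>" "finite_partition M \<gamma>" "finite_partition M \<gamma>'"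
    and "finer \<gamma>' \<gamma>"
  shows "cond_entropy M \<alpha> \<gamma>' \<le> cond_entropy M \<alpha> \<gamma>"
proof -
  have "partition_entropy M (partition_join \<gamma>' \<gamma>) = partition_entropy M \<gamma>'"
    using entropy_join_finer[OF fp(2,3) assms(4)] by (simp add: partition_join_commute)
  moreover have "partition_entropy M (partition_join (partition_join \<alpha> \<gamma>') \<gamma>) =
      partition_entropy M (partition_join \<alpha> \<gamma>')"
    using entropy_join_finer[OF fp(2) finite_partition_join[OF fp(1,3)]]
      finer_trans[OF finer_partition_joinD(2) assms(4)] by (simp add: partition_join_commute)
  ultimately show ?thesis
    using entropy_submodular[OF fp(1,3,2)] by (simp add: cond_entropy_def)
qed

lemma cond_entropy_join_le:
  assumes "finite_partition M \<alpha>" "finite_partition M \<beta>" "finite_partition M \<gamma>"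
  shows "cond_entropy M (partition_join \<alpha> \<beta>) \<gamma> \<le> cond_entropy M \<alpha> \<gamma> + cond_entropy M \<beta> \<gamma>"
  using entropy_submodular[OF assms] by (simp add: cond_entropy_def)

lemma finite_partition_trivial: "finite_partition M {space M}"
  by (simp add: finite_partition_def)

lemma finer_trivial: "finite_partition M \<alpha> \<Longrightarrow> finer \<alpha> {space M}"
  by (auto simp: finer_def finite_partition_def)

lemma cond_entropy_le_entropy:
  assumes "finite_partition M \<alpha>" "finite_partition M \<gamma>"
  shows "cond_entropy M \<alpha> \<gamma> \<le> partition_entropy M \<alpha>"
proof -
  have "partition_entropy M (partition_join {space M} \<alpha>) = partition_entropy M \<alpha>"
    by (intro entropy_join_finer finer_trivial finite_partition_trivial assms)
  moreover have "partition_entropy M {space M} = 0"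
    by (simp add: partition_entropy_def prob_space)
  ultimately show ?thesis
    using cond_entropy_antimono[OF assms(1) finite_partition_trivial assms(2) finer_trivial[OF assms(2)]]
    by (simp add: cond_entropy_def partition_join_commute)
qed

end

section \<open>Two-set partitions\<close>

text \<open>The partition of the space into a set and its complement.\<close>

definition dichotomy :: "'a measure \<Rightarrow> 'a set \<Rightarrow> 'a set set" where
  "dichotomy M A = {A, space M - A}"

lemma finite_partition_dichotomy: "A \<in> sets M \<Longrightarrow> finite_partition M (dichotomy M A)"
  using sets.sets_into_space[of A M]
  by (auto simp: finite_partition_def dichotomy_def disjoint_def)

context prob_space
begin

lemma entropy_dichotomy:
  assumes "A \<in> sets M"
  shows "partition_entropy M (dichotomy M A) =
           - prob A * ln (prob A) - (1 - prob A) * ln (1 - prob A)"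
proof -
  have "A \<noteq> space M - A" using not_empty by auto
  then show ?thesis
    using prob_compl[OF assms] by (simp add: partition_entropy_def dichotomy_def)
qed

lemma entropy_dichotomy_small:
  assumes "\<epsilon> > 0"
  obtains \<delta> where "\<delta> > 0"
    "\<And>A. A \<in> sets M \<Longrightarrow> prob A < \<delta> \<Longrightarrow> partition_entropy M (dichotomy M A) < \<epsilon>"
proof -
  define h :: "real \<Rightarrow> real" where "h p = - p * ln p - (1 - p) * ln (1 - p)" for p
  have "(h \<longlongrightarrow> 0) (at_right 0)"
    unfolding h_def by real_asymp
  then have "eventually (\<lambda>p. h p < \<epsilon>) (at_right 0)"
    using assms by (rule order_tendstoD)
  then obtain \<delta> where \<delta>: "\<delta> > 0" "\<And>p. 0 < p \<Longrightarrow> p < \<delta> \<Longrightarrow> h p < \<epsilon>"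
    unfolding eventually_at_right_field by auto
  show thesis
  proof (rule that[OF \<delta>(1)])
    fix A assume "A \<in> sets M" "prob A < \<delta>"
    moreover have "h 0 = 0" by (simp add: h_def)
    ultimately have "h (prob A) < \<epsilon>"
      using \<delta>(2) assms by (cases "prob A = 0") (auto simp: zero_less_measure_iff)
    then show "partition_entropy M (dichotomy M A) < \<epsilon>"
      using entropy_dichotomy[OF \<open>A \<in> sets M\<close>] by (simp add: h_def)
  qed
qed

text \<open>
  Whether a point lies in \<open>A\<close> is decided by whether it lies in \<open>B\<close> and in the symmetric difference.
\<close>

lemma cond_entropy_dichotomy_le:
  assumes A: "A \<in> sets M" and B: "B \<in> sets M" and \<gamma>: "finite_partition M \<gamma>"
  shows "cond_entropy M (dichotomy M A) \<gamma> \<le>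
           cond_entropy M (dichotomy M B) \<gamma> +
           partition_entropy M (dichotomy M ((A - B) \<union> (B - A)))"
proof -
  define D where "D = (A - B) \<union> (B - A)"
  have D: "D \<in> sets M" using A B by (simp add: D_def)
  note fp = finite_partition_dichotomy[OF A] finite_partition_dichotomy[OF B]
    finite_partition_dichotomy[OF D]
  have "A \<subseteq> space M" "B \<subseteq> space M" using A B sets.sets_into_space by auto
  then have "finer (partition_join (dichotomy M B) (dichotomy M D)) (dichotomy M A)"
    unfolding finer_def partition_join_def dichotomy_def D_def by auto
  then have "cond_entropy M (dichotomy M A) \<gamma> \<le>
      cond_entropy M (partition_join (dichotomy M B) (dichotomy M D)) \<gamma>"
    using cond_entropy_mono finite_partition_join fp \<gamma> by metis
  also have "\<dots> \<le> cond_entropy M (dichotomy M B) \<gamma> + cond_entropy M (dichotomy M D) \<gamma>"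
    using cond_entropy_join_le fp \<gamma> by blast
  also have "cond_entropy M (dichotomy M D) \<gamma> \<le> partition_entropy M (dichotomy M D)"
    using cond_entropy_le_entropy fp \<gamma> by blast
  finally show ?thesis by (simp add: D_def)
qed

lemma cond_entropy_le_sum_dichotomy:
  assumes \<alpha>: "finite_partition M \<alpha>" and \<gamma>: "finite_partition M \<gamma>"
  shows "cond_entropy M \<alpha> \<gamma> \<le> (\<Sum>A\<in>\<alpha>. cond_entropy M (dichotomy M A) \<gamma>)"
proof -
  have "\<exists>\<sigma>. finite_partition M \<sigma> \<and> (\<forall>A\<in>\<A>. finer \<sigma> (dichotomy M A)) \<and>
      cond_entropy M \<sigma> \<gamma> \<le> (\<Sum>A\<in>\<A>. cond_entropy M (dichotomy M A) \<gamma>)"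
    if "finite \<A>" "\<A> \<subseteq> sets M" for \<A>
    using that
  proof (induction \<A> rule: finite_induct)
    case empty
    have "cond_entropy M {space M} \<gamma> = 0"
      using \<gamma> by (intro cond_entropy_eq_0 finer_trivial finite_partition_trivial)
    then show ?case using finite_partition_trivial by (intro exI[of _ "{space M}"]) simp
  next
    case (insert A \<A>)
    then obtain \<sigma> where \<sigma>: "finite_partition M \<sigma>" "\<forall>A\<in>\<A>. finer \<sigma> (dichotomy M A)"
      "cond_entropy M \<sigma> \<gamma> \<le> (\<Sum>A\<in>\<A>. cond_entropy M (dichotomy M A) \<gamma>)" by auto
    have A: "finite_partition M (dichotomy M A)"
      using insert.prems by (auto intro: finite_partition_dichotomy)
    show ?case
    proof (intro exI[of _ "partition_join (dichotomy M A) \<sigma>"] conjI)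
      show "finite_partition M (partition_join (dichotomy M A) \<sigma>)"
        using A \<sigma>(1) by (rule finite_partition_join)
      show "\<forall>B\<in>insert A \<A>. finer (partition_join (dichotomy M A) \<sigma>) (dichotomy M B)"
        using \<sigma>(2) finer_partition_joinD finer_trans by (metis insertE)
      show "cond_entropy M (partition_join (dichotomy M A) \<sigma>) \<gamma> \<le>
          (\<Sum>A\<in>insert A \<A>. cond_entropy M (dichotomy M A) \<gamma>)"
        using cond_entropy_join_le[OF A \<sigma>(1) \<gamma>] \<sigma>(3) insert.hyps by simp
    qed
  qed
  from this[of \<alpha>] \<alpha> obtain \<sigma> where \<sigma>: "finite_partition M \<sigma>"
    "\<forall>A\<in>\<alpha>. finer \<sigma> (dichotomy M A)"
    "cond_entropy M \<sigma> \<gamma> \<le> (\<Sum>A\<in>\<alpha>. cond_entropy M (dichotomy M A) \<gamma>)"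
    unfolding finite_partition_def by blast
  have "finer \<sigma> \<alpha>"
    unfolding finer_def
  proof
    fix S assume S: "S \<in> \<sigma>"
    show "\<exists>A\<in>\<alpha>. S \<subseteq> A"
    proof (cases "S = {}")
      case True
      then show ?thesis using \<alpha> not_empty unfolding finite_partition_def by blast
    next
      case False
      then obtain x where x: "x \<in> S" by blast
      then have "x \<in> space M" using S \<sigma>(1) unfolding finite_partition_def by blast
      then obtain A where A: "A \<in> \<alpha>" "x \<in> A" using \<alpha> unfolding finite_partition_def by blast
      with S \<sigma>(2) have "S \<subseteq> A \<or> S \<subseteq> space M - A" unfolding finer_def dichotomy_def by blast
      with x A show ?thesis by blast
    qed
  qed
  then show ?thesis using cond_entropy_mono[OF \<alpha> \<sigma>(1) \<gamma>] \<sigma>(3) by simp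
qed

end


section \<open>Actions of a finitely generated group\<close>

text \<open>
  A measure-preserving action of a group generated by \<open>s 1, \<dots>, s r\<close>, which may satisfy
  relations.
\<close>

locale generated_mp_system = group G + prob_space M
  for G (structure) and r :: nat and s :: "nat \<Rightarrow> 'g" and M :: "'x measure"
    and T :: "'g \<Rightarrow> 'x \<Rightarrow> 'x" +
  assumes gens: "s ` {1..r} \<subseteq> carrier G"
    and generated: "\<And>g. g \<in> carrier G \<Longrightarrow> \<exists>xs. set xs \<subseteq> sym_gens G r s \<and> list_mult G xs = g"
    and mp: "mp_system G M T"
begin

text \<open>
  In this locale \<open>S\<close> is the symmetric generating set, \<open>wball n\<close> the ball of radius \<open>n\<close> about the
  identity, \<open>tr g \<alpha>\<close> the translate \<open>g\<alpha>\<close>, and \<open>iterate \<alpha> n\<close> the partition \<open>\<alpha>\<^sup>n\<close>.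
\<close>

abbreviation S :: "'g set" where "S \<equiv> sym_gens G r s"
abbreviation wball :: "nat \<Rightarrow> 'g set" where "wball n \<equiv> word_ball G S \<one> n"
abbreviation tr :: "'g \<Rightarrow> 'x set set \<Rightarrow> 'x set set" where "tr g \<equiv> translate (T g)"
abbreviation fp :: "'x set set \<Rightarrow> bool" where "fp \<equiv> finite_partition M"
abbreviation H :: "'x set set \<Rightarrow> real" where "H \<equiv> partition_entropy M"
abbreviation F :: "'x set set \<Rightarrow> real" where "F \<equiv> F_partition r s M T"
abbreviation iterate :: "'x set set \<Rightarrow> nat \<Rightarrow> 'x set set"
  where "iterate \<alpha> n \<equiv> ball_join G r s T \<alpha> n"

subsection \<open>Balls\<close>

lemma S_closed: "S \<subseteq> carrier G"
  using gens by (auto simp: sym_gens_def)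

lemma list_mult_Cons: "list_mult G (x # xs) = x \<otimes> list_mult G xs"
  by (simp add: list_mult_def)

lemma list_mult_Nil: "list_mult G [] = \<one>"
  by (simp add: list_mult_def)

lemma list_mult_closed: "set xs \<subseteq> carrier G \<Longrightarrow> list_mult G xs \<in> carrier G"
  by (induction xs) (auto simp: list_mult_Cons list_mult_Nil)

lemma mem_ball_iff:
  "g \<in> wball n \<longleftrightarrow> (\<exists>xs. set xs \<subseteq> S \<and> length xs \<le> n \<and> list_mult G xs = g)"
proof -
  have "word_length G S g \<le> n \<longleftrightarrow> (\<exists>xs. set xs \<subseteq> S \<and> length xs \<le> n \<and> list_mult G xs = g)"
    if g: "g \<in> carrier G"
  proof
    let ?P = "\<lambda>m. \<exists>xs. set xs \<subseteq> S \<and> length xs = m \<and> list_mult G xs = g"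
    have "\<exists>m. ?P m" using generated[OF g] by auto
    then have "?P (word_length G S g)" unfolding word_length_def by (rule LeastI_ex)
    then show "\<exists>xs. set xs \<subseteq> S \<and> length xs \<le> n \<and> list_mult G xs = g"
      if "word_length G S g \<le> n" using that by auto
    show "word_length G S g \<le> n"
      if *: "\<exists>xs. set xs \<subseteq> S \<and> length xs \<le> n \<and> list_mult G xs = g"
    proof -
      from * obtain xs where xs: "set xs \<subseteq> S" "length xs \<le> n" "list_mult G xs = g" by blast
      then have "word_length G S g \<le> length xs"
        unfolding word_length_def by (intro Least_le) auto
      with xs show ?thesis by simp
    qed
  qed
  moreover have "g \<in> carrier G" if "\<exists>xs. set xs \<subseteq> S \<and> length xs \<le> n \<and> list_mult G xs = g"
    using that S_closed list_mult_closed by blast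
  moreover have "g \<in> wball n \<longleftrightarrow> g \<in> carrier G \<and> word_length G S g \<le> n"
    by (auto simp: word_ball_def word_dist_def)
  ultimately show ?thesis by blast
qed

lemma ball_closed: "wball n \<subseteq> carrier G"
  by (auto simp: word_ball_def)

lemma ball_exhausts: "g \<in> carrier G \<Longrightarrow> \<exists>n. g \<in> wball n"
  using generated unfolding mem_ball_iff by blast

lemma one_in_ball: "\<one> \<in> wball n"
  unfolding mem_ball_iff by (intro exI[of _ "[]"]) (simp add: list_mult_Nil)

lemma ball_0: "wball 0 = {\<one>}"
  by (auto simp: mem_ball_iff list_mult_Nil)

lemma ball_mono: "m \<le> n \<Longrightarrow> wball m \<subseteq> wball n"
  by (auto simp: word_ball_def)

lemma finite_ball: "finite (wball n)"
proof (rule finite_subset)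
  show "wball n \<subseteq> list_mult G ` {xs. set xs \<subseteq> S \<and> length xs \<le> n}"
  proof
    fix g assume "g \<in> wball n"
    then obtain xs where "set xs \<subseteq> S" "length xs \<le> n" "list_mult G xs = g"
      unfolding mem_ball_iff by blast
    then show "g \<in> list_mult G ` {xs. set xs \<subseteq> S \<and> length xs \<le> n}"
      by (intro image_eqI[of _ _ xs]) auto
  qed
  have "finite S" by (simp add: sym_gens_def)
  then show "finite (list_mult G ` {xs. set xs \<subseteq> S \<and> length xs \<le> n})"
    by (intro finite_imageI finite_lists_length_le)
qed

lemma ball_SucI: "t \<in> S \<Longrightarrow> g \<in> wball n \<Longrightarrow> t \<otimes> g \<in> wball (Suc n)"
proof -
  assume "t \<in> S" "g \<in> wball n"
  then obtain xs where "set xs \<subseteq> S" "length xs \<le> n" "list_mult G xs = g"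
    unfolding mem_ball_iff by blast
  with \<open>t \<in> S\<close> show ?thesis
    unfolding mem_ball_iff by (intro exI[of _ "t # xs"]) (auto simp: list_mult_Cons)
qed

lemma ball_SucE:
  assumes "g \<in> wball (Suc n)"
  obtains "g \<in> wball n" | t g' where "t \<in> S" "g' \<in> wball n" "g = t \<otimes> g'"
proof -
  from assms obtain xs where xs: "set xs \<subseteq> S" "length xs \<le> Suc n" "list_mult G xs = g"
    unfolding mem_ball_iff by blast
  show thesis
  proof (cases xs)
    case Nil
    with xs one_in_ball show thesis by (intro that(1)) (simp add: list_mult_Nil)
  next
    case (Cons t ys)
    with xs show thesis
      by (intro that(2)[of t "list_mult G ys"]) (auto simp: mem_ball_iff list_mult_Cons)
  qed
qed

lemma ball_mult:
  assumes "g \<in> wball m" "h \<in> wball n"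
  shows "g \<otimes> h \<in> wball (m + n)"
proof -
  have "list_mult G xs \<otimes> h \<in> wball (length xs + n)" if "set xs \<subseteq> S" for xs
    using that
  proof (induction xs)
    case Nil
    have "h \<in> carrier G" using assms(2) ball_closed by blast
    then show ?case using assms(2) by (simp add: list_mult_Nil)
  next
    case (Cons x xs)
    then have "x \<otimes> (list_mult G xs \<otimes> h) \<in> wball (Suc (length xs + n))"
      by (intro ball_SucI) auto
    moreover have "x \<in> carrier G" "list_mult G xs \<in> carrier G" "h \<in> carrier G"
      using Cons.prems S_closed assms(2) ball_closed by (auto intro!: list_mult_closed)
    ultimately show ?case by (simp add: list_mult_Cons m_assoc)
  qed
  with assms(1) show ?thesis
    using ball_mono[of _ "m + n"] unfolding mem_ball_iff[of g] by (meson add_le_mono1 subsetD)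
qed

subsection \<open>Translates of partitions\<close>

lemma action: "group_action G (space M) T"
  using mp by (simp add: mp_system_def)

lemma inj_T: "g \<in> carrier G \<Longrightarrow> inj_on (T g) (space M)"
  using group_action.inj_prop[OF action] .

lemma T_image_space: "g \<in> carrier G \<Longrightarrow> T g ` space M = space M"
  using group_action.surj_prop[OF action] .

lemma T_mult_image:
  assumes "A \<subseteq> space M" "g \<in> carrier G" "h \<in> carrier G"
  shows "T g ` T h ` A = T (g \<otimes> h) ` A"
  unfolding image_image
proof (rule image_cong[OF refl])
  fix x assume "x \<in> A"
  then show "T g (T h x) = T (g \<otimes> h) x"
    using group_action.composition_rule[OF action _ assms(2,3)] assms(1) by auto
qed

lemma T_one_image:
  assumes "A \<subseteq> space M"
  shows "T \<one> ` A = A"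
proof -
  have "T \<one> x = x" if "x \<in> A" for x
    using group_action.id_eq_one[OF action] that assms by (metis restrict_apply' subsetD)
  then show ?thesis by simp
qed

lemma T_inv_vimage:
  assumes "A \<subseteq> space M" "g \<in> carrier G"
  shows "T g -` A \<inter> space M = T (inv g) ` A"
proof -
  have "T (inv g) ` A \<subseteq> space M" using assms T_image_space[of "inv g"] by auto
  moreover have "T g ` T (inv g) ` A = A"
    using assms T_one_image T_mult_image[of A g "inv g"] by simp
  ultimately have "T (inv g) ` A \<subseteq> T g -` A \<inter> space M" by blast
  moreover have "x \<in> T (inv g) ` A" if "x \<in> space M" "T g x \<in> A" for x
    using that assms group_action.orbit_sym_aux[OF action assms(2) that(1) refl]
    by (intro image_eqI[of _ _ "T g x"]) auto
  ultimately show ?thesis by auto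
qed

lemma T_image_sets_prob:
  assumes "A \<in> sets M" "g \<in> carrier G"
  shows "T g ` A \<in> sets M" "prob (T g ` A) = prob A"
proof -
  have meas: "T (inv g) \<in> measurable M M" "distr M M (T (inv g)) = M"
    using mp assms by (auto simp: mp_system_def)
  have eq: "T g ` A = T (inv g) -` A \<inter> space M"
    using T_inv_vimage[of A "inv g"] assms sets.sets_into_space by auto
  then show "T g ` A \<in> sets M" using meas assms by (simp add: measurable_sets)
  have "prob A = measure (distr M M (T (inv g))) A" using meas by simp
  also have "\<dots> = prob (T (inv g) -` A \<inter> space M)" using meas(1) assms(1) by (rule measure_distr)
  also have "\<dots> = prob (T g ` A)" by (simp only: eq)
  finally show "prob (T g ` A) = prob A" by simp
qed

lemma partition_subset_Pow: "fp \<alpha> \<Longrightarrow> \<alpha> \<subseteq> Pow (space M)"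
  by (auto simp: finite_partition_def)

lemma translate_eq_image: "translate t \<alpha> = (`) t ` \<alpha>"
  by (auto simp: translate_def)

lemma tr_mult:
  assumes "\<alpha> \<subseteq> Pow (space M)" "g \<in> carrier G" "h \<in> carrier G"
  shows "tr g (tr h \<alpha>) = tr (g \<otimes> h) \<alpha>"
proof -
  have "tr g (tr h \<alpha>) = (\<lambda>A. T g ` T h ` A) ` \<alpha>" by (auto simp: translate_def)
  also have "\<dots> = (\<lambda>A. T (g \<otimes> h) ` A) ` \<alpha>"
    by (rule image_cong[OF refl], rule T_mult_image) (use assms in auto)
  finally show ?thesis by (simp add: translate_eq_image)
qed

lemma tr_one:
  assumes "\<alpha> \<subseteq> Pow (space M)"
  shows "tr \<one> \<alpha> = \<alpha>"
proof -
  have "T \<one> ` A = A" if "A \<in> \<alpha>" for A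
    using that assms by (intro T_one_image) auto
  then show ?thesis by (simp add: translate_eq_image)
qed

lemma finite_partition_tr:
  assumes "fp \<alpha>" "g \<in> carrier G"
  shows "fp (tr g \<alpha>)"
proof -
  have \<alpha>: "A \<subseteq> space M" if "A \<in> \<alpha>" for A
    using that assms partition_subset_Pow by auto
  have "disjoint (tr g \<alpha>)"
  proof (rule disjointI)
    fix A B assume "A \<in> tr g \<alpha>" "B \<in> tr g \<alpha>" "A \<noteq> B"
    then obtain A' B' where AB: "A' \<in> \<alpha>" "B' \<in> \<alpha>" "A = T g ` A'" "B = T g ` B'" "A' \<noteq> B'"
      unfolding translate_def by blast
    then show "A \<inter> B = {}"
      using finite_partition_disjointD[OF assms(1), of A' B']
        inj_on_image_Int[OF inj_T[OF assms(2)] \<alpha> \<alpha>, of A' B'] by simp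
  qed
  moreover have "\<Union>(tr g \<alpha>) = T g ` \<Union>\<alpha>"
    by (auto simp: translate_eq_image)
  ultimately show ?thesis
    using assms T_image_sets_prob(1) T_image_space
    unfolding finite_partition_def by (auto simp: translate_eq_image)
qed

lemma entropy_tr:
  assumes "fp \<alpha>" "g \<in> carrier G"
  shows "H (tr g \<alpha>) = H \<alpha>"
proof -
  have "inj_on ((`) (T g)) \<alpha>"
    using inj_on_image_eq_iff[OF inj_T[OF assms(2)]] partition_subset_Pow[OF assms(1)]
    by (intro inj_onI) auto
  moreover have "A \<in> sets M" if "A \<in> \<alpha>" for A using that assms by (auto simp: finite_partition_def)
  ultimately show ?thesis
    using T_image_sets_prob(2)[OF _ assms(2)]
    by (simp add: partition_entropy_def translate_eq_image sum.reindex)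
qed

lemma tr_join:
  assumes "fp \<alpha>" "fp \<beta>" "g \<in> carrier G"
  shows "tr g (partition_join \<alpha> \<beta>) = partition_join (tr g \<alpha>) (tr g \<beta>)"
proof -
  have eq: "T g ` (A \<inter> B) = T g ` A \<inter> T g ` B" if "A \<in> \<alpha>" "B \<in> \<beta>" for A B
    using that assms partition_subset_Pow by (intro inj_on_image_Int[OF inj_T]) auto
  have "tr g (partition_join \<alpha> \<beta>) = (\<lambda>(A, B). T g ` (A \<inter> B)) ` (\<alpha> \<times> \<beta>)"
    by (auto simp: translate_def partition_join_eq_image)
  also have "\<dots> = (\<lambda>(A, B). T g ` A \<inter> T g ` B) ` (\<alpha> \<times> \<beta>)"
    by (rule image_cong[OF refl]) (elim SigmaE, hypsubst, simp only: prod.case, erule (1) eq)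
  also have "\<dots> = partition_join (tr g \<alpha>) (tr g \<beta>)"
    unfolding partition_join_def translate_def by auto
  finally show ?thesis .
qed

lemma cond_entropy_tr:
  assumes "fp \<alpha>" "fp \<gamma>" "g \<in> carrier G"
  shows "cond_entropy M (tr g \<alpha>) (tr g \<gamma>) = cond_entropy M \<alpha> \<gamma>"
  using assms by (simp add: cond_entropy_def tr_join[symmetric] entropy_tr finite_partition_join)

text \<open>Translation by \<open>g\<close> is adjoint to translation by its inverse.\<close>

lemma finer_tr_iff:
  assumes "\<rho> \<subseteq> Pow (space M)" "\<alpha> \<subseteq> Pow (space M)" "g \<in> carrier G"
  shows "finer \<rho> (tr g \<alpha>) \<longleftrightarrow> finer (tr (inv g) \<rho>) \<alpha>"
proof
  assume "finer \<rho> (tr g \<alpha>)"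
  then have "finer (tr (inv g) \<rho>) (tr (inv g) (tr g \<alpha>))" by (rule finer_translate)
  then show "finer (tr (inv g) \<rho>) \<alpha>" using assms by (simp add: tr_mult tr_one)
next
  assume "finer (tr (inv g) \<rho>) \<alpha>"
  then have "finer (tr g (tr (inv g) \<rho>)) (tr g \<alpha>)" by (rule finer_translate)
  then show "finer \<rho> (tr g \<alpha>)" using assms by (simp add: tr_mult tr_one)
qed

subsection \<open>The partitions \<open>\<alpha>\<^sup>n\<close>\<close>

lemma finite_partition_iterate: "fp \<alpha> \<Longrightarrow> fp (iterate \<alpha> n)"
  unfolding ball_join_def
  using finite_ball one_in_ball finite_partition_tr ball_closed
  by (intro finite_partition_Join) blast+

lemma finer_iterate_iff: "finer \<rho> (iterate \<alpha> n) \<longleftrightarrow> (\<forall>g\<in>wball n. finer \<rho> (tr g \<alpha>))"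
  unfolding ball_join_def by (rule finer_partition_Join_iff)

lemma iterate_finer_tr: "g \<in> wball n \<Longrightarrow> finer (iterate \<alpha> n) (tr g \<alpha>)"
  using finer_iterate_iff finer_refl by blast

lemma iterate_mono: "m \<le> n \<Longrightarrow> finer (iterate \<alpha> n) (iterate \<alpha> m)"
  using finer_iterate_iff iterate_finer_tr ball_mono by (meson subsetD)

lemma iterate_finer: "fp \<alpha> \<Longrightarrow> finer (iterate \<alpha> n) \<alpha>"
  using iterate_finer_tr[OF one_in_ball] partition_subset_Pow by (metis tr_one)

lemma iterate_0_finer_iff: "fp \<alpha> \<Longrightarrow> finer \<rho> (iterate \<alpha> 0) \<longleftrightarrow> finer \<rho> \<alpha>"
  using partition_subset_Pow by (simp add: finer_iterate_iff ball_0 tr_one)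

lemma iterate_finer_tr_iterate:
  assumes "fp \<alpha>" "g \<in> wball m"
  shows "finer (iterate \<alpha> (m + n)) (tr g (iterate \<alpha> n))"
proof -
  have g: "g \<in> carrier G" using assms(2) ball_closed by blast
  have pow: "iterate \<alpha> k \<subseteq> Pow (space M)" "\<alpha> \<subseteq> Pow (space M)" for k
    using assms(1) finite_partition_iterate partition_subset_Pow by blast+
  have "finer (tr (inv g) (iterate \<alpha> (m + n))) (tr h \<alpha>)" if h: "h \<in> wball n" for h
  proof -
    have hc: "h \<in> carrier G" using h ball_closed by blast
    have "finer (iterate \<alpha> (m + n)) (tr (g \<otimes> h) \<alpha>)"
      using ball_mult[OF assms(2) h] by (rule iterate_finer_tr)
    then have "finer (iterate \<alpha> (m + n)) (tr g (tr h \<alpha>))"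
      using pow g hc by (simp add: tr_mult)
    moreover have "tr h \<alpha> \<subseteq> Pow (space M)"
      using assms(1) hc finite_partition_tr partition_subset_Pow by blast
    ultimately show ?thesis using finer_tr_iff[OF pow(1) _ g, of "tr h \<alpha>" "m + n"] by simp
  qed
  then have "finer (tr (inv g) (iterate \<alpha> (m + n))) (iterate \<alpha> n)"
    unfolding finer_iterate_iff by blast
  then show ?thesis using finer_tr_iff[OF pow(1) pow(1) g, of "m + n" n] by simp
qed

text \<open>
  A ball of radius \<open>n + 1\<close> is covered by the ball \<open>B\<close> of radius \<open>n\<close> and the sets \<open>t B\<close>, \<open>t \<in> S\<close>.
\<close>

lemma finer_iterate_Suc_iff:
  assumes "fp \<alpha>" "fp \<rho>"
  shows "finer \<rho> (iterate \<alpha> (Suc n)) \<longleftrightarrow>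
           finer \<rho> (iterate \<alpha> n) \<and> (\<forall>t\<in>S. finer \<rho> (tr t (iterate \<alpha> n)))"
proof
  assume L: "finer \<rho> (iterate \<alpha> (Suc n))"
  have "t \<in> wball 1" if "t \<in> S" for t
    using that ball_SucI[OF that one_in_ball[of 0]] S_closed by auto
  then have "finer (iterate \<alpha> (Suc n)) (tr t (iterate \<alpha> n))" if "t \<in> S" for t
    using iterate_finer_tr_iterate[OF assms(1), of t 1 n] that by simp
  then show "finer \<rho> (iterate \<alpha> n) \<and> (\<forall>t\<in>S. finer \<rho> (tr t (iterate \<alpha> n)))"
    using L iterate_mono[of n "Suc n" \<alpha>] finer_trans[of \<rho> "iterate \<alpha> (Suc n)"] by simp
next
  assume R: "finer \<rho> (iterate \<alpha> n) \<and> (\<forall>t\<in>S. finer \<rho> (tr t (iterate \<alpha> n)))"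
  show "finer \<rho> (iterate \<alpha> (Suc n))"
    unfolding finer_iterate_iff
  proof
    fix g assume "g \<in> wball (Suc n)"
    then show "finer \<rho> (tr g \<alpha>)"
    proof (cases rule: ball_SucE)
      case 1
      with R show ?thesis unfolding finer_iterate_iff by blast
    next
      case (2 t h)
      then have "finer \<rho> (tr t (iterate \<alpha> n))" using R by blast
      also have "finer (tr t (iterate \<alpha> n)) (tr t (tr h \<alpha>))"
        using 2 by (intro finer_translate iterate_finer_tr)
      also have "tr t (tr h \<alpha>) = tr g \<alpha>"
        using 2 S_closed ball_closed partition_subset_Pow[OF assms(1)]
        by (simp add: tr_mult subset_iff)
      finally show ?thesis .
    qed
  qed
qed


section \<open>Behaviour of F under refinement\<close>

lemma s_closed: "i \<in> {1..r} \<Longrightarrow> s i \<in> carrier G"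
  using gens by auto

lemma F_cong:
  assumes "fp \<alpha>" "fp \<beta>" "finer \<alpha> \<beta>" "finer \<beta> \<alpha>"
  shows "F \<alpha> = F \<beta>"
proof -
  have "finer (partition_join \<alpha> (tr g \<alpha>)) (partition_join \<beta> (tr g \<beta>))"
    if "finer \<alpha> \<beta>" for \<alpha> \<beta> g
    using finer_trans[OF finer_partition_joinD(1) that]
      finer_trans[OF finer_partition_joinD(2) finer_translate[OF that]]
    by (simp add: finer_partition_join_iff)
  then have "H (partition_join \<alpha> (tr (s i) \<alpha>)) = H (partition_join \<beta> (tr (s i) \<beta>))"
    if "i \<in> {1..r}" for i
    using assms s_closed[OF that]
    by (intro entropy_cong finite_partition_join finite_partition_tr) auto
  moreover have "H \<alpha> = H \<beta>" using assms by (intro entropy_cong)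
  ultimately show ?thesis by (simp add: F_partition_def)
qed

text \<open>
  The join \<open>\<sigma> = \<delta> \<or> \<alpha>\<close> satisfies \<open>\<sigma> \<or> s\<^sub>i \<sigma> = (\<delta> \<or> s\<^sub>i \<delta>) \<or> (\<alpha> \<or> s\<^sub>i \<alpha>)\<close>, whose entropy exceeds that of
  \<open>\<alpha> \<or> s\<^sub>i \<alpha>\<close> by at most two conditional entropies.
\<close>

lemma F_join_le:
  assumes \<alpha>: "fp \<alpha>" and \<delta>: "fp \<delta>"
  shows "F (partition_join \<delta> \<alpha>) \<le> F \<alpha> + (1 - 2 * real r) * cond_entropy M \<delta> \<alpha> +
    (\<Sum>i=1..r. cond_entropy M \<delta> (partition_join \<alpha> (tr (s i) \<alpha>)) +
              cond_entropy M (tr (s i) \<delta>) (partition_join \<alpha> (tr (s i) \<alpha>)))"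
proof -
  let ?\<sigma> = "partition_join \<delta> \<alpha>"
  let ?\<gamma> = "\<lambda>i. partition_join \<alpha> (tr (s i) \<alpha>)"
  let ?e = "\<lambda>i. cond_entropy M \<delta> (?\<gamma> i) + cond_entropy M (tr (s i) \<delta>) (?\<gamma> i)"
  have "H (partition_join ?\<sigma> (tr (s i) ?\<sigma>)) \<le> H (?\<gamma> i) + ?e i" if i: "i \<in> {1..r}" for i
  proof -
    note tr_fp = finite_partition_tr[OF \<alpha> s_closed[OF i]] finite_partition_tr[OF \<delta> s_closed[OF i]]
    have "partition_join ?\<sigma> (tr (s i) ?\<sigma>) =
        partition_join (partition_join \<delta> (tr (s i) \<delta>)) (?\<gamma> i)"
      unfolding tr_join[OF \<delta> \<alpha> s_closed[OF i]] by (metis partition_join_assoc partition_join_commute)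
    then have "H (partition_join ?\<sigma> (tr (s i) ?\<sigma>)) =
        H (?\<gamma> i) + cond_entropy M (partition_join \<delta> (tr (s i) \<delta>)) (?\<gamma> i)"
      by (simp add: cond_entropy_def)
    also have "\<dots> \<le> H (?\<gamma> i) + ?e i"
      using cond_entropy_join_le[OF \<delta> tr_fp(2) finite_partition_join[OF \<alpha> tr_fp(1)]] by simp
    finally show ?thesis .
  qed
  then have "(\<Sum>i=1..r. H (partition_join ?\<sigma> (tr (s i) ?\<sigma>))) \<le> (\<Sum>i=1..r. H (?\<gamma> i) + ?e i)"
    by (intro sum_mono)
  moreover have "H ?\<sigma> = H \<alpha> + cond_entropy M \<delta> \<alpha>"
    by (simp add: cond_entropy_def)
  ultimately show ?thesis
    by (simp add: F_partition_def sum.distrib algebra_simps)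
qed

text \<open>Each of the \<open>2r\<close> terms of the sum in \<open>F_join_le\<close> is at most \<open>H(\<delta> | \<alpha>)\<close>.\<close>

lemma cond_entropy_terms_le:
  assumes \<alpha>: "fp \<alpha>" and \<delta>: "fp \<delta>" and i: "i \<in> {1..r}"
  shows "cond_entropy M \<delta> (partition_join \<alpha> (tr (s i) \<alpha>)) \<le> cond_entropy M \<delta> \<alpha>"
    and "cond_entropy M (tr (s i) \<delta>) (partition_join \<alpha> (tr (s i) \<alpha>)) \<le> cond_entropy M \<delta> \<alpha>"
proof -
  note tr_fp = finite_partition_tr[OF \<alpha> s_closed[OF i]] finite_partition_tr[OF \<delta> s_closed[OF i]]
  note \<gamma> = finite_partition_join[OF \<alpha> tr_fp(1)]
  show "cond_entropy M \<delta> (partition_join \<alpha> (tr (s i) \<alpha>)) \<le> cond_entropy M \<delta> \<alpha>"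
    by (rule cond_entropy_antimono[OF \<delta> \<alpha> \<gamma> finer_partition_joinD(1)])
  have "cond_entropy M (tr (s i) \<delta>) (partition_join \<alpha> (tr (s i) \<alpha>)) \<le>
      cond_entropy M (tr (s i) \<delta>) (tr (s i) \<alpha>)"
    by (rule cond_entropy_antimono[OF tr_fp(2,1) \<gamma> finer_partition_joinD(2)])
  then show "cond_entropy M (tr (s i) \<delta>) (partition_join \<alpha> (tr (s i) \<alpha>)) \<le> cond_entropy M \<delta> \<alpha>"
    using cond_entropy_tr[OF \<delta> \<alpha> s_closed[OF i]] by simp
qed

lemma F_join_le_cond_entropy:
  assumes \<alpha>: "fp \<alpha>" and \<delta>: "fp \<delta>"
  shows "F (partition_join \<delta> \<alpha>) \<le> F \<alpha> + cond_entropy M \<delta> \<alpha>"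
proof -
  have "(\<Sum>i=1..r. cond_entropy M \<delta> (partition_join \<alpha> (tr (s i) \<alpha>)) +
              cond_entropy M (tr (s i) \<delta>) (partition_join \<alpha> (tr (s i) \<alpha>)))
      \<le> (\<Sum>i=1..r. cond_entropy M \<delta> \<alpha> + cond_entropy M \<delta> \<alpha>)"
    by (intro sum_mono add_mono cond_entropy_terms_le assms)
  also have "\<dots> = 2 * real r * cond_entropy M \<delta> \<alpha>" by simp
  finally show ?thesis using F_join_le[OF assms] by (simp add: algebra_simps)
qed

lemma F_le_F_join:
  assumes \<gamma>: "fp \<gamma>" and \<xi>: "fp \<xi>"
  shows "F \<gamma> \<le> F (partition_join \<xi> \<gamma>) + 2 * real r * cond_entropy M \<xi> \<gamma>"
proof -
  let ?\<sigma> = "partition_join \<xi> \<gamma>"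
  have \<sigma>: "fp ?\<sigma>" using \<xi> \<gamma> by (rule finite_partition_join)
  have fin: "finer ?\<sigma> \<gamma>" by (rule finer_partition_joinD)
  have "H (partition_join \<gamma> (tr (s i) \<gamma>)) \<le> H (partition_join ?\<sigma> (tr (s i) ?\<sigma>))"
    if i: "i \<in> {1..r}" for i
  proof (rule entropy_mono)
    show "fp (partition_join \<gamma> (tr (s i) \<gamma>))"
      using \<gamma> s_closed[OF i] by (intro finite_partition_join finite_partition_tr)
    show "fp (partition_join ?\<sigma> (tr (s i) ?\<sigma>))"
      using \<sigma> s_closed[OF i] by (intro finite_partition_join[OF \<sigma>] finite_partition_tr)
    show "finer (partition_join ?\<sigma> (tr (s i) ?\<sigma>)) (partition_join \<gamma> (tr (s i) \<gamma>))"
      using finer_trans[OF finer_partition_joinD(1) fin]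
        finer_trans[OF finer_partition_joinD(2) finer_translate[OF fin]]
      by (simp add: finer_partition_join_iff)
  qed
  then have "(\<Sum>i=1..r. H (partition_join \<gamma> (tr (s i) \<gamma>))) \<le>
      (\<Sum>i=1..r. H (partition_join ?\<sigma> (tr (s i) ?\<sigma>)))"
    by (intro sum_mono)
  moreover have "H ?\<sigma> = H \<gamma> + cond_entropy M \<xi> \<gamma>" by (simp add: cond_entropy_def)
  moreover have "0 \<le> cond_entropy M \<xi> \<gamma>" using cond_entropy_nonneg[OF \<xi> \<gamma>] .
  ultimately show ?thesis by (simp add: F_partition_def algebra_simps)
qed

text \<open>
  Adjoining to \<open>\<alpha>\<close> the translate of a coarser partition by a generator or its inverse does not
  increase \<open>F\<close>.
\<close>

lemma F_simple_splitting:
  assumes \<alpha>: "fp \<alpha>" and \<beta>: "fp \<beta>" and fin: "finer \<alpha> \<beta>" and t: "t \<in> S"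
  shows "F (partition_join (tr t \<beta>) \<alpha>) \<le> F \<alpha>"
proof -
  let ?\<delta> = "tr t \<beta>"
  let ?\<gamma> = "\<lambda>i. partition_join \<alpha> (tr (s i) \<alpha>)"
  define e where "e i = cond_entropy M ?\<delta> (?\<gamma> i) + cond_entropy M (tr (s i) ?\<delta>) (?\<gamma> i)" for i
  define h where "h = cond_entropy M ?\<delta> \<alpha>"
  have tc: "t \<in> carrier G" using t S_closed by blast
  have \<delta>: "fp ?\<delta>" using \<beta> tc by (rule finite_partition_tr)
  have le: "cond_entropy M ?\<delta> (?\<gamma> i) \<le> h" "cond_entropy M (tr (s i) ?\<delta>) (?\<gamma> i) \<le> h"
    if "i \<in> {1..r}" for i
    using cond_entropy_terms_le[OF \<alpha> \<delta> that] by (simp_all add: h_def)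
  from t obtain j where j: "j \<in> {1..r}" "t = s j \<or> t = inv (s j)"
    by (auto simp: sym_gens_def)
  have \<gamma>: "fp (?\<gamma> j)"
    using \<alpha> s_closed[OF j(1)] by (intro finite_partition_join finite_partition_tr)
  \<comment> \<open>For \<open>i = j\<close> one of the two terms vanishes, as \<open>t \<beta>\<close> or \<open>s\<^sub>j t \<beta>\<close> is coarser than \<open>\<alpha> \<or> s\<^sub>j \<alpha>\<close>.
      So only \<open>2r - 1\<close> terms remain, which the coefficient \<open>1 - 2r\<close> compensates.\<close>
  have "e j \<le> h"
    using j(2)
  proof
    assume tj: "t = s j"
    have "finer (?\<gamma> j) ?\<delta>"
      unfolding tj using finer_trans[OF finer_partition_joinD(2) finer_translate[OF fin]] .
    then have "cond_entropy M ?\<delta> (?\<gamma> j) = 0" using \<delta> \<gamma> by (intro cond_entropy_eq_0)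
    then show ?thesis using le(2)[OF j(1)] by (simp add: e_def)
  next
    assume tj: "t = inv (s j)"
    have eq: "tr (s j) ?\<delta> = \<beta>"
      using s_closed[OF j(1)] partition_subset_Pow[OF \<beta>] by (simp add: tj tr_mult tr_one)
    have "finer (?\<gamma> j) \<beta>" using finer_trans[OF finer_partition_joinD(1) fin] .
    then have "cond_entropy M (tr (s j) ?\<delta>) (?\<gamma> j) = 0"
      unfolding eq using \<beta> \<gamma> by (intro cond_entropy_eq_0)
    then show ?thesis using le(1)[OF j(1)] by (simp add: e_def)
  qed
  moreover have "(\<Sum>i\<in>{1..r} - {j}. e i) \<le> (\<Sum>i\<in>{1..r} - {j}. 2 * h)"
  proof (rule sum_mono)
    fix i assume "i \<in> {1..r} - {j}"
    then show "e i \<le> 2 * h" using le[of i] by (simp add: e_def)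
  qed
  moreover have "(\<Sum>i\<in>{1..r} - {j}. 2 * h) = (2 * real r - 2) * h"
    using j(1) by (simp add: of_nat_diff algebra_simps)
  moreover have "(\<Sum>i=1..r. e i) = e j + (\<Sum>i\<in>{1..r} - {j}. e i)"
    using j(1) by (intro sum.remove) auto
  ultimately have "(\<Sum>i=1..r. e i) \<le> (2 * real r - 1) * h" by (simp add: algebra_simps)
  moreover have "F (partition_join ?\<delta> \<alpha>) \<le> F \<alpha> + (1 - 2 * real r) * h + (\<Sum>i=1..r. e i)"
    unfolding e_def h_def by (rule F_join_le[OF \<alpha> \<delta>])
  ultimately show ?thesis by (simp add: algebra_simps)
qed

text \<open>
  The same for several generators at once.  The partition \<open>\<sigma>\<close> is the join of \<open>\<alpha>\<close> with all \<open>t \<beta>\<close>,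
  characterised by its universal property, which determines it up to the empty set.
\<close>

lemma F_splitting:
  assumes \<alpha>: "fp \<alpha>" and \<beta>: "fp \<beta>" and fin: "finer \<alpha> \<beta>" and "finite Q" "Q \<subseteq> S"
  shows "\<exists>\<sigma>. fp \<sigma> \<and> F \<sigma> \<le> F \<alpha> \<and>
    (\<forall>\<rho>. finer \<rho> \<sigma> \<longleftrightarrow> finer \<rho> \<alpha> \<and> (\<forall>t\<in>Q. finer \<rho> (tr t \<beta>)))"
  using assms(4,5)
proof (induction Q rule: finite_induct)
  case empty
  then show ?case using \<alpha> by (intro exI[of _ \<alpha>]) simp
next
  case (insert t Q)
  then obtain \<sigma> where \<sigma>: "fp \<sigma>" "F \<sigma> \<le> F \<alpha>"
    "\<And>\<rho>. finer \<rho> \<sigma> \<longleftrightarrow> finer \<rho> \<alpha> \<and> (\<forall>t\<in>Q. finer \<rho> (tr t \<beta>))" by auto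
  have t: "t \<in> S" "t \<in> carrier G" using insert.prems S_closed by auto
  have "finer \<sigma> \<beta>" using \<sigma>(3)[of \<sigma>] fin finer_trans by auto
  then have "F (partition_join (tr t \<beta>) \<sigma>) \<le> F \<alpha>"
    using F_simple_splitting[OF \<sigma>(1) \<beta> _ t(1)] \<sigma>(2) by simp
  moreover have "fp (partition_join (tr t \<beta>) \<sigma>)"
    using \<beta> \<sigma>(1) t(2) by (intro finite_partition_join finite_partition_tr)
  ultimately show ?case
    using \<sigma>(3) by (intro exI[of _ "partition_join (tr t \<beta>) \<sigma>"]) (auto simp: finer_partition_join_iff)
qed

text \<open>\<open>\<xi> \<or> \<beta>\<^sup>n\<^sup>+\<^sup>1\<close> is the join of \<open>\<xi> \<or> \<beta>\<^sup>n\<close> with the translates \<open>t \<beta>\<^sup>n\<close>, \<open>t \<in> S\<close>.\<close>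

lemma F_join_iterate_Suc:
  assumes \<xi>: "fp \<xi>" and \<beta>: "fp \<beta>"
  shows "F (partition_join \<xi> (iterate \<beta> (Suc n))) \<le> F (partition_join \<xi> (iterate \<beta> n))"
proof -
  let ?\<gamma> = "\<lambda>n. partition_join \<xi> (iterate \<beta> n)"
  have \<gamma>: "fp (?\<gamma> n)" for n
    using \<xi> \<beta> by (intro finite_partition_join finite_partition_iterate)
  have "finite S" by (simp add: sym_gens_def)
  then obtain \<sigma> where \<sigma>: "fp \<sigma>" "F \<sigma> \<le> F (?\<gamma> n)"
    "\<And>\<rho>. finer \<rho> \<sigma> \<longleftrightarrow> finer \<rho> (?\<gamma> n) \<and> (\<forall>t\<in>S. finer \<rho> (tr t (iterate \<beta> n)))"
    using F_splitting[OF \<gamma> finite_partition_iterate[OF \<beta>] finer_partition_joinD(2), of S n] by blast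
  have iff: "finer \<rho> \<sigma> \<longleftrightarrow> finer \<rho> (?\<gamma> (Suc n))" if "fp \<rho>" for \<rho>
    using \<sigma>(3)[of \<rho>] finer_iterate_Suc_iff[OF \<beta> that, of n] by (auto simp: finer_partition_join_iff)
  have "F (?\<gamma> (Suc n)) = F \<sigma>"
    using iff[OF \<gamma>, of "Suc n"] iff[OF \<sigma>(1)] by (intro F_cong \<gamma> \<sigma>(1)) auto
  then show ?thesis using \<sigma>(2) by simp
qed

lemma F_join_iterate_antimono:
  assumes "fp \<xi>" "fp \<beta>" "m \<le> n"
  shows "F (partition_join \<xi> (iterate \<beta> n)) \<le> F (partition_join \<xi> (iterate \<beta> m))"
  using assms(3) F_join_iterate_Suc[OF assms(1,2)]
  by (induction n rule: dec_induct) (auto intro: order_trans)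

lemma F_join_iterate_le:
  assumes "fp \<xi>" "fp \<beta>"
  shows "F (partition_join \<xi> (iterate \<beta> n)) \<le> F (partition_join \<xi> \<beta>)"
proof -
  have "finer \<rho> (partition_join \<xi> (iterate \<beta> 0)) \<longleftrightarrow> finer \<rho> (partition_join \<xi> \<beta>)" for \<rho>
    by (simp add: finer_partition_join_iff iterate_0_finer_iff[OF assms(2)])
  then have "F (partition_join \<xi> (iterate \<beta> 0)) = F (partition_join \<xi> \<beta>)"
    using assms finer_refl by (intro F_cong finite_partition_join finite_partition_iterate) blast+
  then show ?thesis using F_join_iterate_antimono[OF assms, of 0 n] by simp
qed

lemma F_iterate_antimono:
  assumes \<beta>: "fp \<beta>" and "m \<le> n"
  shows "F (iterate \<beta> n) \<le> F (iterate \<beta> m)"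
proof -
  have "F (partition_join {space M} (iterate \<beta> k)) = F (iterate \<beta> k)" for k
  proof (rule F_cong)
    show k: "fp (iterate \<beta> k)" using \<beta> by (rule finite_partition_iterate)
    show "fp (partition_join {space M} (iterate \<beta> k))"
      by (intro finite_partition_join finite_partition_trivial k)
    show "finer (iterate \<beta> k) (partition_join {space M} (iterate \<beta> k))"
      using finer_trivial[OF k] by (simp add: finer_partition_join_iff)
  qed (rule finer_partition_joinD)
  then show ?thesis
    using F_join_iterate_antimono[OF finite_partition_trivial \<beta> assms(2)] by simp
qed

section \<open>Generating partitions\<close>

lemma tr_dichotomy:
  assumes "A \<in> sets M" "g \<in> carrier G"
  shows "tr g (dichotomy M A) = dichotomy M (T g ` A)"
proof -
  have "T g ` (space M - A) = space M - T g ` A"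
    using inj_on_image_set_diff[OF inj_T[OF assms(2)], of "space M" A]
      T_image_space[OF assms(2)] sets.sets_into_space[OF assms(1)] by simp
  then show ?thesis by (simp add: dichotomy_def translate_eq_image)
qed

text \<open>
  The measurable sets \<open>A\<close> that are asymptotically determined by the partitions \<open>\<beta>\<^sup>k\<close>, in the sense
  that the conditional entropy of \<open>{A, X - A}\<close> given \<open>\<beta>\<^sup>k\<close> becomes arbitrarily small.
\<close>

definition determined :: "'x set set \<Rightarrow> 'x set set" where
  "determined \<beta> =
     {A \<in> sets M. \<forall>\<epsilon>>0. \<exists>k. cond_entropy M (dichotomy M A) (iterate \<beta> k) < \<epsilon>}"

lemma determinedI:
  assumes "A \<in> sets M"
    and "\<And>\<epsilon>. \<epsilon> > 0 \<Longrightarrow> \<exists>k. cond_entropy M (dichotomy M A) (iterate \<beta> k) < \<epsilon>"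
  shows "A \<in> determined \<beta>"
  using assms by (simp add: determined_def)

lemma cond_entropy_iterate_antimono:
  assumes "fp \<alpha>" "fp \<beta>" "m \<le> n"
  shows "cond_entropy M \<alpha> (iterate \<beta> n) \<le> cond_entropy M \<alpha> (iterate \<beta> m)"
  using assms by (intro cond_entropy_antimono finite_partition_iterate iterate_mono)

lemma determined_Un:
  assumes \<beta>: "fp \<beta>" and A: "A \<in> determined \<beta>" and B: "B \<in> determined \<beta>"
  shows "A \<union> B \<in> determined \<beta>"
proof (rule determinedI)
  have sets: "A \<in> sets M" "B \<in> sets M" using A B by (auto simp: determined_def)
  then show "A \<union> B \<in> sets M" by simp
  fix \<epsilon> :: real assume "\<epsilon> > 0"
  then have "\<epsilon> / 2 > 0" by simp
  then obtain k l where kl: "cond_entropy M (dichotomy M A) (iterate \<beta> k) < \<epsilon> / 2"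
    "cond_entropy M (dichotomy M B) (iterate \<beta> l) < \<epsilon> / 2"
    using A B unfolding determined_def by blast
  note fps = finite_partition_dichotomy[OF sets(1)] finite_partition_dichotomy[OF sets(2)]
    finite_partition_dichotomy[OF sets.Un[OF sets]]
  let ?\<gamma> = "iterate \<beta> (max k l)"
  have \<gamma>: "fp ?\<gamma>" using \<beta> by (rule finite_partition_iterate)
  have "finer (partition_join (dichotomy M A) (dichotomy M B)) (dichotomy M (A \<union> B))"
    unfolding finer_def partition_join_def dichotomy_def by auto
  then have "cond_entropy M (dichotomy M (A \<union> B)) ?\<gamma> \<le>
      cond_entropy M (partition_join (dichotomy M A) (dichotomy M B)) ?\<gamma>"
    by (intro cond_entropy_mono finite_partition_join fps \<gamma>)
  also have "\<dots> \<le> cond_entropy M (dichotomy M A) ?\<gamma> + cond_entropy M (dichotomy M B) ?\<gamma>"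
    by (intro cond_entropy_join_le fps \<gamma>)
  also have "\<dots> < \<epsilon>"
    using kl cond_entropy_iterate_antimono[OF fps(1) \<beta>, of k "max k l"]
      cond_entropy_iterate_antimono[OF fps(2) \<beta>, of l "max k l"] by simp
  finally show "\<exists>k. cond_entropy M (dichotomy M (A \<union> B)) (iterate \<beta> k) < \<epsilon>" by blast
qed

text \<open>Determined sets are closed under approximation in measure.\<close>

lemma determined_approx:
  assumes \<beta>: "fp \<beta>" and A: "A \<in> sets M"
    and approx: "\<And>\<delta>. \<delta> > 0 \<Longrightarrow> \<exists>B\<in>determined \<beta>. prob ((A - B) \<union> (B - A)) < \<delta>"
  shows "A \<in> determined \<beta>"
proof (rule determinedI[OF A])
  fix \<epsilon> :: real assume "\<epsilon> > 0"
  then have \<epsilon>: "\<epsilon> / 2 > 0" by simp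
  from entropy_dichotomy_small[OF \<epsilon>] obtain \<delta> where \<delta>: "\<delta> > 0"
    "\<And>A. A \<in> sets M \<Longrightarrow> prob A < \<delta> \<Longrightarrow> H (dichotomy M A) < \<epsilon> / 2" by blast
  from approx[OF \<delta>(1)] obtain B where B: "B \<in> determined \<beta>" "prob ((A - B) \<union> (B - A)) < \<delta>" by blast
  then have "B \<in> sets M" by (simp add: determined_def)
  from B(1) \<epsilon> obtain k where k: "cond_entropy M (dichotomy M B) (iterate \<beta> k) < \<epsilon> / 2"
    unfolding determined_def by blast
  have "H (dichotomy M ((A - B) \<union> (B - A))) < \<epsilon> / 2"
    using \<delta>(2) B(2) A \<open>B \<in> sets M\<close> by simp
  then have "cond_entropy M (dichotomy M A) (iterate \<beta> k) < \<epsilon>"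
    using cond_entropy_dichotomy_le[OF A \<open>B \<in> sets M\<close> finite_partition_iterate[OF \<beta>], of k] k by simp
  then show "\<exists>k. cond_entropy M (dichotomy M A) (iterate \<beta> k) < \<epsilon>" by blast
qed

lemma partition_determined:
  assumes \<beta>: "fp \<beta>"
  shows "insert {} \<beta> \<subseteq> determined \<beta>"
proof
  fix A assume A: "A \<in> insert {} \<beta>"
  then have sets: "A \<in> sets M" using \<beta> by (auto simp: finite_partition_def)
  have "B \<subseteq> A \<or> B \<subseteq> space M - A" if "B \<in> \<beta>" for B
    using A that finite_partition_disjointD[OF \<beta>, of A B] partition_subset_Pow[OF \<beta>] by blast
  then have "finer \<beta> (dichotomy M A)" by (auto simp: finer_def dichotomy_def)
  then have "finer (iterate \<beta> 0) (dichotomy M A)"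
    using finer_trans[OF iterate_finer[OF \<beta>]] by blast
  then have "cond_entropy M (dichotomy M A) (iterate \<beta> 0) = 0"
    by (intro cond_entropy_eq_0 finite_partition_dichotomy[OF sets] finite_partition_iterate[OF \<beta>])
  then show "A \<in> determined \<beta>" by (intro determinedI[OF sets]) metis
qed

lemma invariant_sigma_algebra_determined:
  assumes \<beta>: "fp \<beta>"
  shows "invariant_sigma_algebra G M T (determined \<beta>)"
  unfolding invariant_sigma_algebra_def
proof (intro conjI ballI)
  show "sigma_algebra (space M) (determined \<beta>)"
    unfolding sigma_algebra_iff2
  proof (intro conjI ballI allI impI)
    show "determined \<beta> \<subseteq> Pow (space M)"
      using sets.sets_into_space by (auto simp: determined_def)
    show "{} \<in> determined \<beta>" using partition_determined[OF \<beta>] by blast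
  next
    fix A assume A: "A \<in> determined \<beta>"
    then have "A \<in> sets M" by (simp add: determined_def)
    then have "dichotomy M (space M - A) = dichotomy M A"
      using sets.sets_into_space by (auto simp: dichotomy_def)
    with A \<open>A \<in> sets M\<close> show "space M - A \<in> determined \<beta>"
      by (simp add: determined_def sets.compl_sets)
  next
    fix A :: "nat \<Rightarrow> 'x set" assume A: "range A \<subseteq> determined \<beta>"
    have sets: "range A \<subseteq> sets M" using A by (auto simp: determined_def)
    define B where "B n = (\<Union>i\<le>n. A i)" for n
    have B: "B n \<in> determined \<beta>" for n
    proof (induction n)
      case 0
      then show ?case using A by (auto simp: B_def)
    next
      case (Suc n)
      have "B (Suc n) = B n \<union> A (Suc n)" by (auto simp: B_def atMost_Suc)
      then show ?case using determined_Un[OF \<beta> Suc, of "A (Suc n)"] A by auto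
    qed
    then have Bs: "B n \<in> sets M" for n by (simp add: determined_def)
    have UB: "(\<Union>n. B n) = (\<Union>n. A n)" by (auto simp: B_def)
    have "(\<lambda>n. prob (B n)) \<longlonglongrightarrow> prob (\<Union>n. B n)"
      using Bs by (intro finite_Lim_measure_incseq) (auto simp: B_def incseq_def intro: order_trans)
    then have lim: "(\<lambda>n. prob (B n)) \<longlonglongrightarrow> prob (\<Union>n. A n)" by (simp only: UB)
    show "(\<Union>i. A i) \<in> determined \<beta>"
    proof (rule determined_approx[OF \<beta>])
      show U: "(\<Union>i. A i) \<in> sets M" using sets by auto
      fix \<delta> :: real assume "\<delta> > 0"
      then have "eventually (\<lambda>n. prob (\<Union>i. A i) - \<delta> < prob (B n)) sequentially"
        by (intro order_tendstoD(1)[OF lim]) simp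
      then obtain n where n: "prob (\<Union>i. A i) - \<delta> < prob (B n)"
        unfolding eventually_sequentially by blast
      have sub: "B n \<subseteq> (\<Union>i. A i)" by (auto simp: B_def)
      then have "((\<Union>i. A i) - B n) \<union> (B n - (\<Union>i. A i)) = (\<Union>i. A i) - B n" by blast
      then have "prob (((\<Union>i. A i) - B n) \<union> (B n - (\<Union>i. A i))) < \<delta>"
        using n finite_measure_Diff[OF U Bs sub] by simp
      with B show "\<exists>B\<in>determined \<beta>. prob (((\<Union>i. A i) - B) \<union> (B - (\<Union>i. A i))) < \<delta>" by blast
    qed
  qed
next
  fix g A assume g: "g \<in> carrier G" and A: "A \<in> determined \<beta>"
  then have sets: "A \<in> sets M" by (simp add: determined_def)
  note dA = finite_partition_dichotomy[OF sets]
  from ball_exhausts[OF g] obtain m where m: "g \<in> wball m" by blast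
  show "T g ` A \<in> determined \<beta>"
  proof (rule determinedI)
    show "T g ` A \<in> sets M" using T_image_sets_prob(1)[OF sets g] .
    fix \<epsilon> :: real assume "\<epsilon> > 0"
    with A obtain k where k: "cond_entropy M (dichotomy M A) (iterate \<beta> k) < \<epsilon>"
      unfolding determined_def by blast
    have "cond_entropy M (tr g (dichotomy M A)) (iterate \<beta> (m + k)) \<le>
        cond_entropy M (tr g (dichotomy M A)) (tr g (iterate \<beta> k))"
      using \<beta> g m dA
      by (intro cond_entropy_antimono finite_partition_tr finite_partition_iterate
            iterate_finer_tr_iterate)
    also have "\<dots> = cond_entropy M (dichotomy M A) (iterate \<beta> k)"
      using \<beta> g dA by (intro cond_entropy_tr finite_partition_iterate)
    finally show "\<exists>k. cond_entropy M (dichotomy M (T g ` A)) (iterate \<beta> k) < \<epsilon>"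
      using k tr_dichotomy[OF sets g] by (intro exI[of _ "m + k"]) simp
  qed
qed

text \<open>
  The determined sets form an invariant \<open>\<sigma>\<close>-algebra containing \<open>\<beta>\<close>; hence every measurable set is
  determined when \<open>\<beta>\<close> is generating.
\<close>

lemma generating_cond_entropy_small:
  assumes \<beta>: "fp \<beta>" and gen: "generating G M T \<beta>" and \<alpha>: "fp \<alpha>" and \<epsilon>: "\<epsilon> > 0"
  shows "\<exists>k. cond_entropy M \<alpha> (iterate \<beta> k) < \<epsilon>"
proof -
  have sub: "smallest_invariant_sigma_algebra G M T \<beta> \<subseteq> determined \<beta>"
    unfolding smallest_invariant_sigma_algebra_def
    using invariant_sigma_algebra_determined[OF \<beta>] partition_determined[OF \<beta>] by blast
  have det: "A \<in> determined \<beta>" if A: "A \<in> sets M" for A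
  proof (intro determined_approx[OF \<beta> A])
    fix \<delta> :: real assume "\<delta> > 0"
    from gen A obtain B where B: "B \<in> smallest_invariant_sigma_algebra G M T \<beta>"
      "(A - B) \<union> (B - A) \<in> null_sets M"
      unfolding generating_def by blast
    from B(2) have "prob ((A - B) \<union> (B - A)) = 0" by (simp add: measure_eq_0_null_sets)
    with \<open>\<delta> > 0\<close> B(1) sub show "\<exists>B\<in>determined \<beta>. prob ((A - B) \<union> (B - A)) < \<delta>"
      by (intro bexI[of _ B]) auto
  qed
  define c where "c = real (card \<alpha>) + 1"
  have c: "c > 0" "\<epsilon> / c > 0" using \<epsilon> by (auto simp: c_def add_nonneg_pos)
  have sets: "A \<in> sets M" if "A \<in> \<alpha>" for A using that \<alpha> by (auto simp: finite_partition_def)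
  have "\<forall>A\<in>\<alpha>. \<exists>k. cond_entropy M (dichotomy M A) (iterate \<beta> k) < \<epsilon> / c"
    using det sets c(2) unfolding determined_def by blast
  then obtain k where k: "\<And>A. A \<in> \<alpha> \<Longrightarrow> cond_entropy M (dichotomy M A) (iterate \<beta> (k A)) < \<epsilon> / c"
    by metis
  define K where "K = Max (insert 0 (k ` \<alpha>))"
  have K: "k A \<le> K" if "A \<in> \<alpha>" for A
    using that \<alpha> by (auto simp: K_def finite_partition_def)
  have "cond_entropy M \<alpha> (iterate \<beta> K) \<le> (\<Sum>A\<in>\<alpha>. cond_entropy M (dichotomy M A) (iterate \<beta> K))"
    using \<alpha> \<beta> by (intro cond_entropy_le_sum_dichotomy finite_partition_iterate)
  also have "\<dots> \<le> (\<Sum>A\<in>\<alpha>. \<epsilon> / c)"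
  proof (rule sum_mono)
    fix A assume A: "A \<in> \<alpha>"
    show "cond_entropy M (dichotomy M A) (iterate \<beta> K) \<le> \<epsilon> / c"
      using cond_entropy_iterate_antimono[OF finite_partition_dichotomy[OF sets[OF A]] \<beta> K[OF A]]
        k[OF A] by simp
  qed
  also have "\<dots> = real (card \<alpha>) * \<epsilon> / c" by simp
  also have "\<dots> < \<epsilon>" using c \<epsilon> by (simp add: pos_divide_less_eq c_def algebra_simps)
  finally show ?thesis by blast
qed

section \<open>Independence of the generating partition\<close>

lemma f_partition_le:
  assumes \<alpha>: "finite_generating_partition G M T \<alpha>" and \<beta>: "finite_generating_partition G M T \<beta>"
  shows "f_partition G r s M T \<beta> \<le> f_partition G r s M T \<alpha>"
proof -
  have fps: "fp \<alpha>" "fp \<beta>" and gens: "generating G M T \<alpha>" "generating G M T \<beta>"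
    using \<alpha> \<beta> by (auto simp: finite_generating_partition_def)
  have bound: "\<exists>k. F (iterate \<beta> k) \<le> F (iterate \<alpha> n) + (2 * real r + 1) * \<delta>" if \<delta>: "\<delta> > 0" for n \<delta>
  proof -
    obtain l where l: "cond_entropy M \<beta> (iterate \<alpha> l) < \<delta>"
      using generating_cond_entropy_small[OF fps(1) gens(1) fps(2) \<delta>] by blast
    \<comment> \<open>First \<open>\<xi>\<close> is chosen to make \<open>H(\<beta> | \<xi>)\<close> small, then \<open>k\<close>, depending on \<open>\<xi>\<close>, to make
        \<open>H(\<xi> | \<beta>\<^sup>k)\<close> small.\<close>
    define \<xi> where "\<xi> = iterate \<alpha> (max n l)"
    have \<xi>: "fp \<xi>" unfolding \<xi>_def using fps(1) by (rule finite_partition_iterate)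
    obtain k where k: "cond_entropy M \<xi> (iterate \<beta> k) < \<delta>"
      using generating_cond_entropy_small[OF fps(2) gens(2) \<xi> \<delta>] by blast
    have "F (iterate \<beta> k) \<le> F (partition_join \<xi> (iterate \<beta> k)) + 2 * real r * cond_entropy M \<xi> (iterate \<beta> k)"
      using fps(2) \<xi> by (intro F_le_F_join finite_partition_iterate)
    also have "\<dots> \<le> F (partition_join \<xi> (iterate \<beta> k)) + 2 * real r * \<delta>"
      using k by (intro add_left_mono mult_left_mono) auto
    also have "F (partition_join \<xi> (iterate \<beta> k)) \<le> F (partition_join \<xi> \<beta>)"
      using \<xi> fps(2) by (rule F_join_iterate_le)
    also have "F (partition_join \<xi> \<beta>) \<le> F \<xi> + cond_entropy M \<beta> \<xi>"
      using F_join_le_cond_entropy[OF \<xi> fps(2)] by (simp add: partition_join_commute)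
    also have "cond_entropy M \<beta> \<xi> \<le> \<delta>"
      using cond_entropy_iterate_antimono[OF fps(2,1), of l "max n l"] l by (simp add: \<xi>_def)
    also have "F \<xi> \<le> F (iterate \<alpha> n)"
      unfolding \<xi>_def using fps(1) by (rule F_iterate_antimono) simp
    finally show ?thesis by (intro exI[of _ k]) (simp add: algebra_simps)
  qed
  show ?thesis
    unfolding f_partition_def
  proof (rule INF_greatest)
    fix n
    show "(INF k. ereal (F (iterate \<beta> k))) \<le> ereal (F (iterate \<alpha> n))"
    proof (rule ereal_le_epsilon2)
      fix \<epsilon> :: real assume "\<epsilon> > 0"
      then have "\<epsilon> / (2 * real r + 1) > 0" by (simp add: add_nonneg_pos)
      from bound[OF this, of n] obtain k where "F (iterate \<beta> k) \<le> F (iterate \<alpha> n) + \<epsilon>" by auto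
      then show "(INF k. ereal (F (iterate \<beta> k))) \<le> ereal (F (iterate \<alpha> n)) + ereal \<epsilon>"
        by (intro INF_lower2[of k]) auto
    qed
  qed
qed

lemma f_partition_eq:
  assumes "finite_generating_partition G M T \<alpha>" "finite_generating_partition G M T \<beta>"
  shows "f_partition G r s M T \<alpha> = f_partition G r s M T \<beta>"
  using f_partition_le assms by (intro antisym) auto

lemma f_invariant_eq:
  assumes "finite_generating_partition G M T \<alpha>"
  shows "f_invariant G r s M T = f_partition G r s M T \<alpha>"
  unfolding f_invariant_def using f_partition_eq assms by (intro the_equality) blast+

end


section \<open>Conjugate systems\<close>

text \<open>
  A measure conjugacy \<open>\<phi>\<close> between invariant conull sets \<open>X\<close> and \<open>Y\<close> of two systems.
\<close>

locale conjugate_systems =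
  src: generated_mp_system G r s M T + tgt: generated_mp_system G r s N U
  for G (structure) and r s and M :: "'x measure" and T and N :: "'y measure" and U +
  fixes X :: "'x set" and Y :: "'y set" and \<phi> :: "'x \<Rightarrow> 'y"
  assumes X: "X \<in> sets M" "space M - X \<in> null_sets M"
    and Y: "Y \<in> sets N" "space N - Y \<in> null_sets N"
    and bij: "bij_betw \<phi> X Y"
    and measurable_\<phi>: "\<phi> \<in> measurable (restrict_space M X) (restrict_space N Y)"
    and measurable_inv: "the_inv_into X \<phi> \<in> measurable (restrict_space N Y) (restrict_space M X)"
    and distr_\<phi>: "distr (restrict_space M X) (restrict_space N Y) \<phi> = restrict_space N Y"
    and equivariant: "\<And>g x. g \<in> carrier G \<Longrightarrow> x \<in> X \<Longrightarrow> T g x \<in> X \<and> \<phi> (T g x) = U g (\<phi> x)"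
begin

text \<open>The preimage under \<open>\<phi>\<close>, which is only meaningful on \<open>X\<close>.\<close>

definition pre :: "'y set \<Rightarrow> 'x set" where "pre B = \<phi> -` B \<inter> X"

text \<open>
  The pullback of a partition of the target; the null set on which \<open>\<phi>\<close> is not defined is added
  as a further member.
\<close>

definition pullback :: "'y set set \<Rightarrow> 'x set set" where
  "pullback \<rho> = insert (space M - X) (pre ` \<rho>)"

lemma X_subset: "X \<subseteq> space M" and Y_subset: "Y \<subseteq> space N"
  using X Y sets.sets_into_space by auto

lemma \<phi>_in_Y: "x \<in> X \<Longrightarrow> \<phi> x \<in> Y"
  using bij bij_betwE by blast

lemma pre_sets: "B \<in> sets N \<Longrightarrow> pre B \<in> sets M"
  and prob_pre: "B \<in> sets N \<Longrightarrow> measure M (pre B) = measure N B"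
proof -
  assume B: "B \<in> sets N"
  have spX: "space (restrict_space M X) = X" and XM: "X \<inter> space M \<in> sets M"
    and YN: "Y \<inter> space N \<in> sets N"
    using X Y X_subset by (auto simp: space_restrict_space)
  have BY: "B \<inter> Y \<in> sets (restrict_space N Y)"
    using B Y by (auto simp: sets_restrict_space_iff)
  have pre: "pre B = \<phi> -` (B \<inter> Y) \<inter> space (restrict_space M X)"
    using \<phi>_in_Y by (auto simp: pre_def spX)
  have "pre B \<in> sets (restrict_space M X)"
    unfolding pre using measurable_\<phi> BY by (rule measurable_sets)
  then show "pre B \<in> sets M" using XM by (simp add: sets_restrict_space_iff)
  have "measure M (pre B) = measure (restrict_space M X) (pre B)"
    using XM by (intro measure_restrict_space[symmetric]) (auto simp: pre_def)
  also have "\<dots> = measure (distr (restrict_space M X) (restrict_space N Y) \<phi>) (B \<inter> Y)"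
    unfolding pre using measurable_\<phi> BY by (rule measure_distr[symmetric])
  also have "\<dots> = measure N (B \<inter> Y)"
    unfolding distr_\<phi> using YN by (intro measure_restrict_space) auto
  also have "B \<inter> Y = B - (space N - Y)" using sets.sets_into_space[OF B] by blast
  also have "measure N \<dots> = measure N B"
    using B Y(2) by (rule measure_Diff_null_set)
  finally show "measure M (pre B) = measure N B" .
qed

lemma pre_Int: "pre (A \<inter> B) = pre A \<inter> pre B"
  by (auto simp: pre_def)

lemma finite_partition_pullback:
  assumes \<rho>: "finite_partition N \<rho>"
  shows "finite_partition M (pullback \<rho>)"
proof -
  have "disjoint (pullback \<rho>)"
  proof (rule disjointI)
    fix P Q assume PQ: "P \<in> pullback \<rho>" "Q \<in> pullback \<rho>" "P \<noteq> Q"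
    show "P \<inter> Q = {}"
    proof (cases "P = space M - X \<or> Q = space M - X")
      case True
      with PQ show ?thesis unfolding pullback_def by (auto simp: pre_def)
    next
      case False
      with PQ obtain A B where AB: "A \<in> \<rho>" "B \<in> \<rho>" "P = pre A" "Q = pre B" "A \<noteq> B"
        unfolding pullback_def by blast
      then have "A \<inter> B = {}" using finite_partition_disjointD[OF \<rho>] by blast
      with AB show ?thesis by (simp add: pre_Int[symmetric]) (simp add: pre_def)
    qed
  qed
  moreover have "\<Union>(pullback \<rho>) = (space M - X) \<union> pre (\<Union>\<rho>)"
    by (auto simp: pullback_def pre_def)
  moreover have "pre (space N) = X" using \<phi>_in_Y Y_subset by (auto simp: pre_def)
  ultimately show ?thesis
    using \<rho> pre_sets X X_subset unfolding finite_partition_def pullback_def by auto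
qed

lemma entropy_pullback:
  assumes \<rho>: "finite_partition N \<rho>"
  shows "partition_entropy M (pullback \<rho>) = partition_entropy N \<rho>"
proof -
  let ?\<eta> = "\<lambda>A. measure M A * ln (measure M A)"
  have sets: "B \<in> sets N" if "B \<in> \<rho>" for B
    using \<rho> that by (auto simp: finite_partition_def)
  have fin: "finite \<rho>" using \<rho> by (simp add: finite_partition_def)
  have "measure M (space M - X) = 0" using X(2) by (rule measure_eq_0_null_sets)
  then have "sum ?\<eta> (pullback \<rho>) = sum ?\<eta> (pre ` \<rho>)"
    using fin by (simp add: pullback_def sum.insert_if)
  also have "\<dots> = sum (?\<eta> \<circ> pre) \<rho>"
  proof (rule sum.reindex_nontrivial[OF fin])
    fix A B assume "A \<in> \<rho>" "B \<in> \<rho>" "A \<noteq> B" "pre A = pre B"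
    then have "pre A = pre (A \<inter> B)" by (simp add: pre_Int)
    also have "A \<inter> B = {}" by (rule finite_partition_disjointD[OF \<rho>]) fact+
    finally have "pre A = {}" by (simp add: pre_def)
    then show "?\<eta> (pre A) = 0" by simp
  qed
  also have "\<dots> = (\<Sum>B\<in>\<rho>. measure N B * ln (measure N B))"
    using sets by (intro sum.cong) (auto simp: prob_pre)
  finally show ?thesis by (simp add: partition_entropy_def)
qed

lemma finer_pullback:
  assumes "finer \<rho> \<rho>'"
  shows "finer (pullback \<rho>) (pullback \<rho>')"
  unfolding finer_def
proof
  fix P assume "P \<in> pullback \<rho>"
  then consider "P = space M - X" | B where "B \<in> \<rho>" "P = pre B" unfolding pullback_def by blast
  then show "\<exists>Q\<in>pullback \<rho>'. P \<subseteq> Q"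
  proof cases
    case 1
    then show ?thesis by (auto simp: pullback_def)
  next
    case 2
    then obtain B' where "B' \<in> \<rho>'" "B \<subseteq> B'" using assms unfolding finer_def by blast
    with 2 show ?thesis by (intro bexI[of _ "pre B'"]) (auto simp: pullback_def pre_def)
  qed
qed

text \<open>
  Pullbacks commute with joins, up to the empty set.
\<close>

lemma finer_Join_pullback:
  assumes "K \<noteq> {}"
  shows "finer (partition_Join K (\<lambda>g. pullback (P g))) (pullback (partition_Join K P))"
    and "finer (pullback (partition_Join K P)) (partition_Join K (\<lambda>g. pullback (P g)))"
proof -
  show "finer (pullback (partition_Join K P)) (partition_Join K (\<lambda>g. pullback (P g)))"
    unfolding finer_partition_Join_iff
    using finer_partition_Join_iff[of "partition_Join K P" K P] by (simp add: finer_pullback)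
  show "finer (partition_Join K (\<lambda>g. pullback (P g))) (pullback (partition_Join K P))"
    unfolding finer_def
  proof
    fix D assume "D \<in> partition_Join K (\<lambda>g. pullback (P g))"
    then obtain c where c: "\<forall>g\<in>K. c g \<in> pullback (P g)" "D = (\<Inter>g\<in>K. c g)"
      by (rule partition_JoinE)
    show "\<exists>Q\<in>pullback (partition_Join K P). D \<subseteq> Q"
    proof (cases "\<exists>g\<in>K. c g = space M - X")
      case True
      then obtain g where g: "g \<in> K" "c g = space M - X" by blast
      with c(2) have "D \<subseteq> space M - X" by blast
      then show ?thesis by (intro bexI[of _ "space M - X"]) (auto simp: pullback_def)
    next
      case False
      have "\<forall>g\<in>K. \<exists>B. B \<in> P g \<and> c g = pre B"
      proof
        fix g assume g: "g \<in> K"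
        with c(1) have "c g \<in> pullback (P g)" by blast
        with g False show "\<exists>B. B \<in> P g \<and> c g = pre B" unfolding pullback_def by auto
      qed
      then obtain b where b: "\<forall>g\<in>K. b g \<in> P g \<and> c g = pre (b g)" by metis
      from assms obtain g0 where g0: "g0 \<in> K" by blast
      have "D \<subseteq> pre (\<Inter>g\<in>K. b g)"
        using b g0 unfolding c(2) pre_def by auto
      moreover have "(\<Inter>g\<in>K. b g) \<in> partition_Join K P"
        using b by (intro partition_JoinI) blast
      ultimately show ?thesis unfolding pullback_def by blast
    qed
  qed
qed

lemma finer_join_pullback:
  "finer (partition_join (pullback \<rho>) (pullback \<rho>')) (pullback (partition_join \<rho> \<rho>'))"
  "finer (pullback (partition_join \<rho> \<rho>')) (partition_join (pullback \<rho>) (pullback \<rho>'))"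
proof -
  show "finer (pullback (partition_join \<rho> \<rho>')) (partition_join (pullback \<rho>) (pullback \<rho>'))"
    by (simp add: finer_partition_join_iff finer_pullback finer_partition_joinD)
  show "finer (partition_join (pullback \<rho>) (pullback \<rho>')) (pullback (partition_join \<rho> \<rho>'))"
    unfolding finer_def
  proof
    fix D assume "D \<in> partition_join (pullback \<rho>) (pullback \<rho>')"
    then obtain P Q where PQ: "P \<in> pullback \<rho>" "Q \<in> pullback \<rho>'" "D = P \<inter> Q"
      unfolding partition_join_def by blast
    show "\<exists>Q\<in>pullback (partition_join \<rho> \<rho>'). D \<subseteq> Q"
    proof (cases "P = space M - X \<or> Q = space M - X")
      case True
      with PQ(3) show ?thesis by (intro bexI[of _ "space M - X"]) (auto simp: pullback_def)
    next
      case False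
      with PQ obtain A B where "A \<in> \<rho>" "B \<in> \<rho>'" "P = pre A" "Q = pre B"
        unfolding pullback_def by blast
      with PQ(3) have "A \<inter> B \<in> partition_join \<rho> \<rho>'" "D = pre (A \<inter> B)"
        by (auto simp: partition_join_def pre_Int)
      then show ?thesis unfolding pullback_def by blast
    qed
  qed
qed

lemma pre_image:
  assumes g: "g \<in> carrier G" and B: "B \<subseteq> space N"
  shows "pre (U g ` B) = T g ` pre B"
proof (intro equalityI subsetI)
  fix x assume "x \<in> pre (U g ` B)"
  then obtain b where b: "x \<in> X" "b \<in> B" "\<phi> x = U g b" by (auto simp: pre_def)
  have gi: "inv g \<in> carrier G" using g by simp
  have "b \<in> space N" using b B by blast
  then have "U (inv g) (\<phi> x) = b"
    using group_action.orbit_sym_aux[OF tgt.action g] b(3) by simp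
  then have "T (inv g) x \<in> pre B"
    using equivariant[OF gi b(1)] b(2) by (simp add: pre_def)
  moreover have "T g (T (inv g) x) = x"
    using group_action.orbit_sym_aux[OF src.action gi, of x] b(1) X_subset g by auto
  ultimately show "x \<in> T g ` pre B" by (metis imageI)
next
  fix x assume "x \<in> T g ` pre B"
  then show "x \<in> pre (U g ` B)"
    using equivariant[OF g] by (auto simp: pre_def)
qed

lemma pullback_translate:
  assumes g: "g \<in> carrier G" and \<rho>: "finite_partition N \<rho>"
  shows "pullback (translate (U g) \<rho>) = translate (T g) (pullback \<rho>)"
proof -
  have \<rho>_sub: "B \<subseteq> space N" if "B \<in> \<rho>" for B
    using tgt.partition_subset_Pow[OF \<rho>] that by blast
  have "pre (space N) = X" using \<phi>_in_Y Y_subset by (auto simp: pre_def)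
  then have "T g ` X = X"
    using pre_image[OF g subset_refl] tgt.T_image_space[OF g] by simp
  then have "T g ` (space M - X) = space M - X"
    using inj_on_image_set_diff[OF src.inj_T[OF g], of "space M" X] src.T_image_space[OF g] X_subset
    by auto
  moreover have "pre ` translate (U g) \<rho> = translate (T g) (pre ` \<rho>)"
    unfolding tgt.translate_eq_image src.translate_eq_image image_image
    by (rule image_cong[OF refl]) (rule pre_image[OF g \<rho>_sub])
  ultimately show ?thesis by (simp add: pullback_def src.translate_eq_image)
qed

lemma finer_iterate_pullback:
  assumes \<rho>: "finite_partition N \<rho>"
  shows "finer (src.iterate (pullback \<rho>) n) (pullback (tgt.iterate \<rho> n))"
    and "finer (pullback (tgt.iterate \<rho> n)) (src.iterate (pullback \<rho>) n)"
proof -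
  have ne: "src.wball n \<noteq> {}" using src.one_in_ball by blast
  have eq: "src.iterate (pullback \<rho>) n =
      partition_Join (src.wball n) (\<lambda>g. pullback (translate (U g) \<rho>))"
    unfolding ball_join_def partition_Join_def
    using pullback_translate[OF _ \<rho>] src.ball_closed[of n] by (simp add: subset_iff)
  show "finer (src.iterate (pullback \<rho>) n) (pullback (tgt.iterate \<rho> n))"
    unfolding eq unfolding ball_join_def by (rule finer_Join_pullback[OF ne])
  show "finer (pullback (tgt.iterate \<rho> n)) (src.iterate (pullback \<rho>) n)"
    unfolding eq unfolding ball_join_def by (rule finer_Join_pullback[OF ne])
qed

lemma F_pullback:
  assumes \<rho>: "finite_partition N \<rho>"
  shows "src.F (pullback \<rho>) = tgt.F \<rho>"
proof -
  have "src.H (partition_join (pullback \<rho>) (translate (T (s i)) (pullback \<rho>))) =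
      tgt.H (partition_join \<rho> (translate (U (s i)) \<rho>))" if i: "i \<in> {1..r}" for i
  proof -
    have tr: "finite_partition N (translate (U (s i)) \<rho>)"
      using \<rho> src.s_closed[OF i] by (rule tgt.finite_partition_tr)
    have "src.H (partition_join (pullback \<rho>) (translate (T (s i)) (pullback \<rho>))) =
        src.H (partition_join (pullback \<rho>) (pullback (translate (U (s i)) \<rho>)))"
      using pullback_translate[OF src.s_closed[OF i] \<rho>] by simp
    also have "\<dots> = src.H (pullback (partition_join \<rho> (translate (U (s i)) \<rho>)))"
      by (intro src.entropy_cong finite_partition_join finite_partition_pullback finer_join_pullback \<rho> tr)
    also have "\<dots> = tgt.H (partition_join \<rho> (translate (U (s i)) \<rho>))"
      by (intro entropy_pullback finite_partition_join \<rho> tr)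
    finally show ?thesis .
  qed
  then show ?thesis by (simp add: F_partition_def entropy_pullback[OF \<rho>])
qed

lemma f_partition_pullback:
  assumes \<rho>: "finite_partition N \<rho>"
  shows "f_partition G r s M T (pullback \<rho>) = f_partition G r s N U \<rho>"
proof -
  have "src.F (src.iterate (pullback \<rho>) n) = tgt.F (tgt.iterate \<rho> n)" for n
  proof -
    have "src.F (src.iterate (pullback \<rho>) n) = src.F (pullback (tgt.iterate \<rho> n))"
      by (intro src.F_cong src.finite_partition_iterate finite_partition_pullback
          tgt.finite_partition_iterate finer_iterate_pullback \<rho>)
    also have "\<dots> = tgt.F (tgt.iterate \<rho> n)"
      by (intro F_pullback tgt.finite_partition_iterate \<rho>)
    finally show ?thesis .
  qed
  then show ?thesis by (simp add: f_partition_def)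
qed

lemma generating_pullback:
  assumes \<rho>: "finite_partition N \<rho>" and gen: "generating G N U \<rho>"
  shows "generating G M T (pullback \<rho>)"
  unfolding generating_def
proof
  let ?\<S> = "smallest_invariant_sigma_algebra G M T (pullback \<rho>)"
  \<comment> \<open>The sets whose preimage is in the invariant \<open>\<sigma>\<close>-algebra generated by the pullback.\<close>
  define \<B> where "\<B> = {D. D \<subseteq> space N \<and> pre D \<in> ?\<S>}"
  have S_iff: "P \<in> ?\<S> \<longleftrightarrow>
      (\<forall>\<A>. invariant_sigma_algebra G M T \<A> \<and> pullback \<rho> \<subseteq> \<A> \<longrightarrow> P \<in> \<A>)" for P
    unfolding smallest_invariant_sigma_algebra_def by blast
  have inv_N: "pre D \<in> \<A>"
    if "D \<in> \<B>" "invariant_sigma_algebra G M T \<A>" "pullback \<rho> \<subseteq> \<A>" for D \<A>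
    using that unfolding \<B>_def S_iff by blast
  have preN: "pre (space N) = X" using \<phi>_in_Y Y_subset by (auto simp: pre_def)
  have "invariant_sigma_algebra G N U \<B>"
    unfolding invariant_sigma_algebra_def
  proof (intro conjI ballI)
    show "sigma_algebra (space N) \<B>"
      unfolding sigma_algebra_iff2
    proof (intro conjI ballI allI impI)
      show "\<B> \<subseteq> Pow (space N)" by (auto simp: \<B>_def)
      have "pre {} \<in> ?\<S>"
        unfolding S_iff by (auto simp: pre_def invariant_sigma_algebra_def sigma_algebra_iff2)
      then show "{} \<in> \<B>" by (simp add: \<B>_def)
    next
      fix D assume D: "D \<in> \<B>"
      have "pre (space N - D) \<in> \<A>"
        if \<A>: "invariant_sigma_algebra G M T \<A>" "pullback \<rho> \<subseteq> \<A>" for \<A>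
      proof -
        interpret \<A>: sigma_algebra "space M" \<A> using \<A>(1) by (simp add: invariant_sigma_algebra_def)
        have "space M - X \<in> \<A>" using \<A>(2) by (auto simp: pullback_def)
        then have "space M - ((space M - X) \<union> pre D) \<in> \<A>" using inv_N[OF D \<A>] by auto
        moreover have "pre (space N - D) = space M - ((space M - X) \<union> pre D)"
          using preN X_subset by (auto simp: pre_def)
        ultimately show ?thesis by simp
      qed
      then show "space N - D \<in> \<B>" unfolding \<B>_def S_iff by blast
    next
      fix D :: "nat \<Rightarrow> 'y set" assume D: "range D \<subseteq> \<B>"
      have "pre (\<Union>n. D n) \<in> \<A>"
        if \<A>: "invariant_sigma_algebra G M T \<A>" "pullback \<rho> \<subseteq> \<A>" for \<A>
      proof -
        interpret \<A>: sigma_algebra "space M" \<A> using \<A>(1) by (simp add: invariant_sigma_algebra_def)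
        have "(\<Union>n. pre (D n)) \<in> \<A>" using inv_N[OF _ \<A>] D by (intro \<A>.countable_UN) auto
        moreover have "pre (\<Union>n. D n) = (\<Union>n. pre (D n))" by (auto simp: pre_def)
        ultimately show ?thesis by simp
      qed
      moreover have "(\<Union>n. D n) \<subseteq> space N" using D by (auto simp: \<B>_def)
      ultimately show "(\<Union>n. D n) \<in> \<B>" unfolding \<B>_def S_iff by blast
    qed
  next
    fix g D assume g: "g \<in> carrier G" and D: "D \<in> \<B>"
    then have sub: "D \<subseteq> space N" by (simp add: \<B>_def)
    have "pre (U g ` D) \<in> \<A>"
      if \<A>: "invariant_sigma_algebra G M T \<A>" "pullback \<rho> \<subseteq> \<A>" for \<A>
      using inv_N[OF D \<A>] \<A>(1) g unfolding pre_image[OF g sub] invariant_sigma_algebra_def by blast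
    moreover have "U g ` D \<subseteq> space N" using sub tgt.T_image_space[OF g] by blast
    ultimately show "U g ` D \<in> \<B>" unfolding \<B>_def S_iff by blast
  qed
  moreover have "\<rho> \<subseteq> \<B>"
  proof
    fix B assume "B \<in> \<rho>"
    then have "B \<subseteq> space N" "pre B \<in> pullback \<rho>"
      using tgt.partition_subset_Pow[OF \<rho>] by (auto simp: pullback_def)
    then show "B \<in> \<B>" unfolding \<B>_def S_iff by blast
  qed
  ultimately have sub: "smallest_invariant_sigma_algebra G N U \<rho> \<subseteq> \<B>"
    unfolding smallest_invariant_sigma_algebra_def by blast
  fix A assume A: "A \<in> sets M"
  define C where "C = the_inv_into X \<phi> -` (A \<inter> X) \<inter> Y"
  have "A \<inter> X \<in> sets (restrict_space M X)"
    using A X by (auto simp: sets_restrict_space_iff)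
  then have "the_inv_into X \<phi> -` (A \<inter> X) \<inter> space (restrict_space N Y) \<in> sets (restrict_space N Y)"
    by (rule measurable_sets[OF measurable_inv])
  moreover have "space (restrict_space N Y) = Y" using Y_subset by (auto simp: space_restrict_space)
  ultimately have C: "C \<in> sets N" using Y by (auto simp: C_def sets_restrict_space_iff)
  have "the_inv_into X \<phi> (\<phi> x) = x" if "x \<in> X" for x
    using bij that by (intro the_inv_into_f_f) (auto simp: bij_betw_def)
  then have pre_C: "pre C = A \<inter> X"
    using \<phi>_in_Y by (auto simp: pre_def C_def)
  from gen C obtain D where D: "D \<in> smallest_invariant_sigma_algebra G N U \<rho>"
    "(C - D) \<union> (D - C) \<in> null_sets N"
    unfolding generating_def by blast
  have null: "pre ((C - D) \<union> (D - C)) \<in> null_sets M"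
  proof -
    have sets: "(C - D) \<union> (D - C) \<in> sets N" using D(2) by blast
    have "measure M (pre ((C - D) \<union> (D - C))) = 0"
      using prob_pre[OF sets] D(2) by (simp add: measure_eq_0_null_sets)
    then show ?thesis using pre_sets[OF sets] src.emeasure_eq_measure by (intro null_setsI) auto
  qed
  have sub_null: "(A - pre D) \<union> (pre D - A) \<subseteq> pre ((C - D) \<union> (D - C)) \<union> (space M - X)"
    using pre_C sets.sets_into_space[OF A] by (auto simp: pre_def)
  have "pre D \<in> ?\<S>" using D(1) sub by (auto simp: \<B>_def)
  moreover have "pre D \<in> sets M"
  proof -
    have "invariant_sigma_algebra G M T (sets M)"
      using src.T_image_sets_prob(1) sets.sigma_algebra_axioms by (auto simp: invariant_sigma_algebra_def)
    moreover have "pullback \<rho> \<subseteq> sets M"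
      using finite_partition_pullback[OF \<rho>] by (simp add: finite_partition_def)
    ultimately show ?thesis using \<open>pre D \<in> ?\<S>\<close> unfolding S_iff by blast
  qed
  then have "(A - pre D) \<union> (pre D - A) \<in> null_sets M"
    using A null_sets_subset[OF null_sets.Un[OF null X(2)] _ sub_null] by auto
  ultimately show "\<exists>B\<in>?\<S>. (A - B) \<union> (B - A) \<in> null_sets M" by blast
qed

lemma finite_generating_partition_pullback:
  "finite_generating_partition G N U \<rho> \<Longrightarrow> finite_generating_partition G M T (pullback \<rho>)"
  using generating_pullback finite_partition_pullback
  by (simp add: finite_generating_partition_def)

lemma f_invariant_conjugate:
  assumes "finite_generating_partition G N U \<rho>"
  shows "f_invariant G r s M T = f_invariant G r s N U"
  using src.f_invariant_eq[OF finite_generating_partition_pullback[OF assms]]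
    tgt.f_invariant_eq[OF assms] f_partition_pullback assms
  by (simp add: finite_generating_partition_def)

end

section \<open>Free groups\<close>

lemma free_group_generated_mp_system:
  assumes free: "free_group_on G r s" and mp: "mp_system G M T"
  shows "generated_mp_system G r s M T"
proof -
  interpret group G using free by (simp add: free_group_on_def)
  interpret prob_space M using mp by (simp add: mp_system_def)
  show ?thesis
  proof
    show "s ` {1..r} \<subseteq> carrier G" using free by (simp add: free_group_on_def)
    show "mp_system G M T" by fact
    fix g assume "g \<in> carrier G"
    then obtain w where w: "w \<in> reduced_words r" "g = word_eval G s w"
      using free unfolding free_group_on_def bij_betw_def by blast
    let ?xs = "map (\<lambda>(i, b). if b then s i else inv\<^bsub>G\<^esub> (s i)) w"
    have "set ?xs \<subseteq> sym_gens G r s"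
    proof
      fix x assume "x \<in> set ?xs"
      then obtain i b where ib: "(i, b) \<in> set w" "x = (if b then s i else inv\<^bsub>G\<^esub> (s i))" by auto
      then have "i \<in> {1..r}" using w(1) unfolding reduced_words_def by force
      then show "x \<in> sym_gens G r s" using ib(2) by (simp add: sym_gens_def)
    qed
    then show "\<exists>xs. set xs \<subseteq> sym_gens G r s \<and> list_mult G xs = g"
      using w(2) by (intro exI[of _ ?xs]) (simp add: word_eval_def)
  qed
qed

theorem theorem1p3:
  fixes G :: "('g, 'c) monoid_scheme" and r :: nat and s :: "nat \<Rightarrow> 'g"
    and M :: "'x measure" and T :: "'g \<Rightarrow> 'x \<Rightarrow> 'x"
  assumes "free_group_on G r s"
    and "mp_system G M T"
  shows "(\<forall>\<alpha> \<beta>. finite_generating_partition G M T \<alpha> \<longrightarrow> finite_generating_partition G M T \<beta> \<longrightarrow>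
            f_partition G r s M T \<alpha> = f_partition G r s M T \<beta>) \<and>
         (\<forall>(N :: 'y measure) (U :: 'g \<Rightarrow> 'y \<Rightarrow> 'y).
            mp_system G N U \<longrightarrow>
            measurably_conjugate G M T N U \<longrightarrow>
            (\<exists>\<alpha>. finite_generating_partition G M T \<alpha>) \<longrightarrow>
            (\<exists>\<beta>. finite_generating_partition G N U \<beta>) \<longrightarrow>
            f_invariant G r s M T = f_invariant G r s N U)"
proof (intro conjI allI impI)
  have src: "generated_mp_system G r s M T"
    using assms by (rule free_group_generated_mp_system)
  show "f_partition G r s M T \<alpha> = f_partition G r s M T \<beta>"
    if "finite_generating_partition G M T \<alpha>" "finite_generating_partition G M T \<beta>" for \<alpha> \<beta>
    using generated_mp_system.f_partition_eq[OF src that] .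
  fix N :: "'y measure" and U :: "'g \<Rightarrow> 'y \<Rightarrow> 'y"
  assume mp: "mp_system G N U" and conj: "measurably_conjugate G M T N U"
    and gen: "\<exists>\<beta>. finite_generating_partition G N U \<beta>"
  have tgt: "generated_mp_system G r s N U"
    using assms(1) mp by (rule free_group_generated_mp_system)
  from conj obtain X Y \<phi> where "conjugate_systems_axioms G M T N U X Y \<phi>"
    unfolding measurably_conjugate_def conjugate_systems_axioms_def by blast
  with src tgt have "conjugate_systems G r s M T N U X Y \<phi>"
    by (simp add: conjugate_systems_def)
  with gen show "f_invariant G r s M T = f_invariant G r s N U"
    using conjugate_systems.f_invariant_conjugate by blast
qed

end
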